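(* Let $p$ be a prime and let $R$ be a perfect ring of characteristic $p$ equipped with a power-multiplicative nonarchimedean seminorm $|\bullet|$. Let $b>0$. Then the seminorm $|\bullet|_{W,b}$ on $\underleftarrow{W}^b(R)$ is power-multiplicative, and via the natural isomorphism $W(R)\cong\underleftarrow{W}(R)$, $\underleftarrow{W}^b(R)$ corresponds to the subring of $W(R)$ consisting of those $\underline{x}=(x_1,x_p,x_{p^2},\dots)$ for which $p^{-bn}|x_{p^n}|^{p^{-n}}\to0$ as $n\to\infty$. Thus $\underleftarrow{W}^\dagger(R)$ corresponds to the usual overconvergent Witt ring, i.e. the set of $\underline{x}\in W(R)$ for which there exists $b>0$ with $p^{-bn}|x_{p^n}|^{p^{-n}}\to0$ as $n\to\infty$.
   Context: All rings are commutative and unital. A nonarchimedean seminorm on an abelian group $R$ is a function $|\bullet|:R\to[0,+\infty)$ with $|0|=0$ and $|x+y|\le\max\{|x|,|y|\}$. On a ring it is submultiplicative if $|xy|\le|x||y|$ for all $x,y$, and power-multiplicative if it is submultiplicative and $|x^2|\ge|x|^2$ for all $x$. $W$ is the functor of $p$-typical Witt vectors with components $(x_1,x_p,x_{p^2},\dots)$; $W_{p^n}(R)$ is the truncation with components $(x_1,\dots,x_{p^n})$. The Frobenius $F$ is the natural ring homomorphism determined on ghost components $w_{p^n}=\sum_{0\le i\le n}p^ix_{p^i}^{p^{n-i}}$ by $w_{p^n}\circ F=w_{p^{n+1}}$, inducing $F:W_{p^{n+1}}(R)\to W_{p^n}(R)$. $\underleftarrow{W}(R)$ is the inverse limit of the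 $W_{p^n}(R)$, $n\ge0$, along $F$, with elements $\underline{x}=(\underline{x}_{p^{-n}})_{n\ge0}$, $\underline{x}_{p^{-n}}\in W_{p^n}(R)$. On $W_{p^r}(R)$ put $|(x_{p^n})_{0\le n\le r}|_W=\sup\{|x_{p^n}|^{1/p^n}:0\le n\le r\}$. For $b>0$, $\underleftarrow{W}^b(R)$ is the set of $\underline{x}\in\underleftarrow{W}(R)$ with $p^{-bn}|\underline{x}_{p^{-n}}|_W^{p^n}\to0$ as $n\to\infty$, with the seminorm $|\underline{x}|_{W,b}=\sup_n\{p^{-bn}|\underline{x}_{p^{-n}}|_W^{p^n}\}$, and $\underleftarrow{W}^\dagger(R)=\bigcup_{b>0}\underleftarrow{W}^b(R)$. When $R$ is perfect of characteristic $p$, $F$ is bijective on $W(R)$ (it is induced by the $p$-power map of $R$), and the natural isomorphism $W(R)\cong\varprojlim_F W(R)\cong\underleftarrow{W}(R)$ sends $\underline{x}$ to the sequence whose $n$-th term is the truncation of $F^{-n}(\underline{x})$ to $W_{p^n}(R)$, namely $(x_1^{p^{-n}},x_p^{p^{-n}},\dots,x_{p^n}^{p^{-n}})$. *)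

theory Defs
  imports Complex_Main "HOL-Library.Poly_Mapping" "HOL-Algebra.Algebra"
    "HOL-Algebra.Algebraic_Closure_Type"
begin

text \<open>
  The base ring \<open>R\<close> is a type of class \<open>comm_ring_1\<close>, viewed through
  \<^const>\<open>ring_of_type_algebra\<close> where a ring record is required; the rings built from it are
  HOL-Algebra records. The component \<open>x\<^bsub>p^n\<^esub>\<close> of a \<open>p\<close>-typical Witt vector is stored at index \<open>n\<close>.
\<close>

section \<open>Seminorms\<close>

definition nonarch_seminorm :: "('a, 'm) ring_scheme \<Rightarrow> ('a \<Rightarrow> real) \<Rightarrow> bool" where
  "nonarch_seminorm R N \<longleftrightarrow>
     (\<forall>x\<in>carrier R. 0 \<le> N x) \<and>
     N \<zero>\<^bsub>R\<^esub> = 0 \<and>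
     (\<forall>x\<in>carrier R. \<forall>y\<in>carrier R. N (x \<oplus>\<^bsub>R\<^esub> y) \<le> max (N x) (N y))"

definition submultiplicative :: "('a, 'm) ring_scheme \<Rightarrow> ('a \<Rightarrow> real) \<Rightarrow> bool" where
  "submultiplicative R N \<longleftrightarrow>
     (\<forall>x\<in>carrier R. \<forall>y\<in>carrier R. N (x \<otimes>\<^bsub>R\<^esub> y) \<le> N x * N y)"

definition power_multiplicative :: "('a, 'm) ring_scheme \<Rightarrow> ('a \<Rightarrow> real) \<Rightarrow> bool" where
  "power_multiplicative R N \<longleftrightarrow>
     submultiplicative R N \<and> (\<forall>x\<in>carrier R. N (x \<otimes>\<^bsub>R\<^esub> x) \<ge> (N x)\<^sup>2)"


section \<open>Integer polynomials\<close>

text \<open>Polynomials over \<open>\<int>\<close> in variables indexed by \<open>'v\<close>: finitely supported coefficient functions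
  on monomials, a monomial being a finitely supported exponent function.\<close>

type_synonym 'v int_mpoly = "('v \<Rightarrow>\<^sub>0 nat) \<Rightarrow>\<^sub>0 int"

definition var :: "'v \<Rightarrow> 'v int_mpoly" where
  "var v = Poly_Mapping.single (Poly_Mapping.single v 1) 1"

definition eval :: "('v \<Rightarrow> 'a::comm_ring_1) \<Rightarrow> 'v int_mpoly \<Rightarrow> 'a" where
  "eval f P = (\<Sum>m\<in>Poly_Mapping.keys P. of_int (Poly_Mapping.lookup P m) *
                 (\<Prod>v\<in>Poly_Mapping.keys m. f v ^ Poly_Mapping.lookup m v))"


section \<open>Witt vectors\<close>

definition ghost :: "nat \<Rightarrow> nat \<Rightarrow> (nat \<Rightarrow> 'a::comm_ring_1) \<Rightarrow> 'a" where
  "ghost p n x = (\<Sum>i\<le>n. of_nat p ^ i * x i ^ (p ^ (n - i)))"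

text \<open>
  The universal polynomials for addition, multiplication and Frobenius, determined by their ghost
  components. They are unique because integer polynomial rings are torsion-free, and they exist by
  Dwork's lemma; their \<open>n\<close>-th members involve only variables of index \<open>\<le> n\<close> (addition,
  multiplication) or \<open>\<le> n + 1\<close> (Frobenius). The variables \<open>Inl i\<close> and \<open>Inr i\<close> stand for the
  \<open>i\<close>-th components of the first and the second argument.
\<close>

definition witt_add_poly :: "nat \<Rightarrow> nat \<Rightarrow> (nat + nat) int_mpoly" where
  "witt_add_poly p =
     (THE S. \<forall>n. ghost p n S = ghost p n (\<lambda>i. var (Inl i)) + ghost p n (\<lambda>i. var (Inr i)))"

definition witt_mult_poly :: "nat \<Rightarrow> nat \<Rightarrow> (nat + nat) int_mpoly" where
  "witt_mult_poly p =
     (THE S. \<forall>n. ghost p n S = ghost p n (\<lambda>i. var (Inl i)) * ghost p n (\<lambda>i. var (Inr i)))"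

definition witt_frob_poly :: "nat \<Rightarrow> nat \<Rightarrow> nat int_mpoly" where
  "witt_frob_poly p = (THE S. \<forall>n. ghost p n S = ghost p (Suc n) var)"

definition witt_add :: "nat \<Rightarrow> (nat \<Rightarrow> 'a::comm_ring_1) \<Rightarrow> (nat \<Rightarrow> 'a) \<Rightarrow> nat \<Rightarrow> 'a" where
  "witt_add p x y n = eval (case_sum x y) (witt_add_poly p n)"

definition witt_mult :: "nat \<Rightarrow> (nat \<Rightarrow> 'a::comm_ring_1) \<Rightarrow> (nat \<Rightarrow> 'a) \<Rightarrow> nat \<Rightarrow> 'a" where
  "witt_mult p x y n = eval (case_sum x y) (witt_mult_poly p n)"

definition witt_frob :: "nat \<Rightarrow> (nat \<Rightarrow> 'a::comm_ring_1) \<Rightarrow> nat \<Rightarrow> 'a" where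
  "witt_frob p x n = eval x (witt_frob_poly p n)"

definition witt_zero :: "nat \<Rightarrow> 'a::comm_ring_1" where
  "witt_zero n = 0"

definition witt_one :: "nat \<Rightarrow> 'a::comm_ring_1" where
  "witt_one n = (if n = 0 then 1 else 0)"

definition witt_ring :: "nat \<Rightarrow> (nat \<Rightarrow> 'a::comm_ring_1) ring" where
  "witt_ring p = \<lparr> carrier = UNIV, monoid.mult = witt_mult p, one = witt_one,
                   ring.zero = witt_zero, add = witt_add p \<rparr>"

text \<open>\<open>W\<^bsub>p^r\<^esub>(R)\<close>, on functions on \<open>{..r}\<close> extended by \<^const>\<open>undefined\<close>. By the remark on
  variables above, the operations below do not depend on the values outside \<open>{..r}\<close>.\<close>

definition witt_trunc :: "nat \<Rightarrow> (nat \<Rightarrow> 'a) \<Rightarrow> nat \<Rightarrow> 'a" where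
  "witt_trunc r x = restrict x {..r}"

definition witt_trunc_ring :: "nat \<Rightarrow> nat \<Rightarrow> (nat \<Rightarrow> 'a::comm_ring_1) ring" where
  "witt_trunc_ring p r =
     \<lparr> carrier = {..r} \<rightarrow>\<^sub>E UNIV,
       monoid.mult = (\<lambda>x y. witt_trunc r (witt_mult p x y)),
       one = witt_trunc r witt_one,
       ring.zero = witt_trunc r witt_zero,
       add = (\<lambda>x y. witt_trunc r (witt_add p x y)) \<rparr>"

text \<open>The Frobenius \<open>F : W\<^bsub>p^(r+1)\<^esub>(R) \<rightarrow> W\<^bsub>p^r\<^esub>(R)\<close>.\<close>

definition witt_trunc_frob :: "nat \<Rightarrow> nat \<Rightarrow> (nat \<Rightarrow> 'a::comm_ring_1) \<Rightarrow> nat \<Rightarrow> 'a" where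
  "witt_trunc_frob p r x = witt_trunc r (witt_frob p x)"


section \<open>The inverse limit along Frobenius\<close>

text \<open>The entry \<open>x n\<close> is the component of index \<open>p^(-n)\<close>, an element of \<open>W\<^bsub>p^n\<^esub>(R)\<close>.\<close>

definition invlim_witt_ring :: "nat \<Rightarrow> (nat \<Rightarrow> nat \<Rightarrow> 'a::comm_ring_1) ring" where
  "invlim_witt_ring p =
     \<lparr> carrier = {x. (\<forall>n. x n \<in> carrier (witt_trunc_ring p n)) \<and>
                     (\<forall>n. witt_trunc_frob p n (x (Suc n)) = x n)},
       monoid.mult = (\<lambda>x y n. x n \<otimes>\<^bsub>witt_trunc_ring p n\<^esub> y n),
       one = (\<lambda>n. \<one>\<^bsub>witt_trunc_ring p n\<^esub>),
       ring.zero = (\<lambda>n. \<zero>\<^bsub>witt_trunc_ring p n\<^esub>),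
       add = (\<lambda>x y n. x n \<oplus>\<^bsub>witt_trunc_ring p n\<^esub> y n) \<rparr>"

text \<open>The natural map \<open>W(R) \<rightarrow> lim\<^sub>F W\<^bsub>p^n\<^esub>(R)\<close> when \<open>F\<close> is bijective on \<open>W(R)\<close>: the
  \<open>n\<close>-th term is the truncation of \<open>F^(-n)(x)\<close> to \<open>W\<^bsub>p^n\<^esub>(R)\<close>.\<close>

definition witt_to_invlim :: "nat \<Rightarrow> (nat \<Rightarrow> 'a::comm_ring_1) \<Rightarrow> nat \<Rightarrow> nat \<Rightarrow> 'a" where
  "witt_to_invlim p x n = witt_trunc n ((inv_into UNIV (witt_frob p) ^^ n) x)"


section \<open>Growth conditions\<close>

definition witt_trunc_norm :: "nat \<Rightarrow> ('a \<Rightarrow> real) \<Rightarrow> nat \<Rightarrow> (nat \<Rightarrow> 'a) \<Rightarrow> real" where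
  "witt_trunc_norm p N r x = (SUP n\<in>{..r}. N (x n) powr (1 / real p ^ n))"

definition invlim_term :: "nat \<Rightarrow> ('a \<Rightarrow> real) \<Rightarrow> real \<Rightarrow> (nat \<Rightarrow> nat \<Rightarrow> 'a) \<Rightarrow> nat \<Rightarrow> real" where
  "invlim_term p N b x n = real p powr (- b * real n) * witt_trunc_norm p N n (x n) ^ (p ^ n)"

definition invlim_b ::
    "nat \<Rightarrow> ('a::comm_ring_1 \<Rightarrow> real) \<Rightarrow> real \<Rightarrow> (nat \<Rightarrow> nat \<Rightarrow> 'a) set" where
  "invlim_b p N b =
     {x \<in> carrier (invlim_witt_ring p). invlim_term p N b x \<longlonglongrightarrow> 0}"

text \<open>The supremum is used on \<^const>\<open>invlim_b\<close> only, where the terms are bounded.\<close>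

definition invlim_norm :: "nat \<Rightarrow> ('a \<Rightarrow> real) \<Rightarrow> real \<Rightarrow> (nat \<Rightarrow> nat \<Rightarrow> 'a) \<Rightarrow> real" where
  "invlim_norm p N b x = (SUP n. invlim_term p N b x n)"

definition invlim_dagger ::
    "nat \<Rightarrow> ('a::comm_ring_1 \<Rightarrow> real) \<Rightarrow> (nat \<Rightarrow> nat \<Rightarrow> 'a) set" where
  "invlim_dagger p N = (\<Union>b\<in>{0<..}. invlim_b p N b)"

definition witt_b :: "nat \<Rightarrow> ('a::comm_ring_1 \<Rightarrow> real) \<Rightarrow> real \<Rightarrow> (nat \<Rightarrow> 'a) set" where
  "witt_b p N b =
     {x \<in> carrier (witt_ring p).
        (\<lambda>n. real p powr (- b * real n) * N (x n) powr (1 / real p ^ n)) \<longlonglongrightarrow> 0}"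

definition overconvergent_witt :: "nat \<Rightarrow> ('a::comm_ring_1 \<Rightarrow> real) \<Rightarrow> (nat \<Rightarrow> 'a) set" where
  "overconvergent_witt p N =
     {x \<in> carrier (witt_ring p). \<exists>b>0.
        (\<lambda>n. real p powr (- b * real n) * N (x n) powr (1 / real p ^ n)) \<longlonglongrightarrow> 0}"

end

theory Submission
  imports Defs
begin

text \<open>
  Let \<open>a\<^sub>i(x) = |x\<^sub>i| ^ (1 / p\<^sup>i)\<close>, where \<open>x\<^sub>i\<close> is the component of index \<open>p\<^sup>i\<close> of a Witt vector \<open>x\<close>.
  In characteristic \<open>p\<close> the Witt vector Frobenius raises components to the \<open>p\<close>-th power
  (\<open>witt_frob_eq_power\<close>). So for perfect \<open>R\<close> a compatible sequence \<open>y\<close> is determined by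
  \<open>x\<^sub>i = (y\<^sub>i)\<^sub>i ^ (p\<^sup>i)\<close>, and as the universal operations up to degree \<open>n\<close> only involve components up
  to degree \<open>n\<close>, this gives the isomorphism \<open>witt_to_invlim_iso\<close>. By power-multiplicativity of
  the seminorm of \<open>R\<close>, the \<open>n\<close>-th term that defines \<open>|x|\<^sub>W\<^sub>,\<^sub>b\<close> is the maximum of
  \<open>p ^ (- b n) a\<^sub>i(x)\<close> over \<open>i \<le> n\<close> (\<open>invlim_term_le_iff\<close>). Hence these terms tend to \<open>0\<close> if and
  only if \<open>p ^ (- b i) a\<^sub>i(x)\<close> does, and \<open>|x|\<^sub>W\<^sub>,\<^sub>b\<close> is the supremum of the numbers
  \<open>p ^ (- b i) a\<^sub>i(x)\<close>. All other claims concern this weighted supremum on \<open>W(R)\<close>.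

  Sums: if \<open>a\<^sub>i(x)\<close> and \<open>a\<^sub>i(y)\<close> are at most \<open>C\<close> for \<open>i \<le> n\<close>, then \<open>a\<^sub>n(x + y) \<le> C\<close>
  (\<open>N_witt_add\<close>). This is read off from ghost components over the polynomial ring with one
  variable for every element of \<open>R\<close>, where all monomials of the \<open>i\<close>-th ghost components have size
  at most \<open>C ^ (p\<^sup>i)\<close>. So every bound \<open>a\<^sub>i(x) \<le> c\<^sub>i\<close> with \<open>c\<close> nondecreasing is stable under addition.

  Products: up to any given degree, \<open>x\<close> is the sum of finitely many \<open>V\<^sup>i[x\<^sub>i]\<close>. In characteristic \<open>p\<close>,
  \<open>V\<^sup>i[x\<^sub>i] V\<^sup>j[y\<^sub>j]\<close> has a single component, in degree \<open>i + j\<close> and of radius at most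
  \<open>a\<^sub>i(x) a\<^sub>j(y)\<close> (\<open>witt_mult_single\<close>). So \<open>c\<close> for \<open>x\<close> and \<open>d\<close> for \<open>y\<close> give the bound \<open>e\<close> for
  \<open>x y\<close> whenever \<open>e\<close> is nondecreasing and \<open>c\<^sub>i d\<^sub>j \<le> e\<^sub>i\<^sub>+\<^sub>j\<close> (\<open>witt_bounded_mult\<close>). For multiples of
  the weight \<open>p ^ (b i)\<close> this is submultiplicativity. The growth condition itself says that for every
  \<open>\<epsilon> > 0\<close> there is a constant \<open>D\<close> with \<open>a\<^sub>i(x) \<le> max D (\<epsilon> p ^ (b i))\<close> (\<open>mem_witt_b_iff_bounded\<close>); bounds
  of this shape pass to sums and products in the same way, which gives the subrings.

  Squares: let \<open>n\<close> be the first degree in which the supremum \<open>M > 0\<close> of \<open>p ^ (- b i) a\<^sub>i(x)\<close> is attained.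
  In \<open>x\<^sup>2\<close>, the square of \<open>V\<^sup>n[x\<^sub>n]\<close> contributes weighted size \<open>M\<^sup>2\<close> in degree \<open>2 n\<close>, and the remaining
  products are strictly smaller up to this degree (\<open>witt_bounded_of_square\<close>).
\<close>

section \<open>Evaluation of integer polynomials\<close>

definition monom_eval :: "('v \<Rightarrow> 'c::comm_monoid_mult) \<Rightarrow> ('v \<Rightarrow>\<^sub>0 nat) \<Rightarrow> 'c" where
  "monom_eval f m = (\<Prod>v\<in>Poly_Mapping.keys m. f v ^ Poly_Mapping.lookup m v)"

lemma monom_eval_superset:
  assumes "finite S" "Poly_Mapping.keys m \<subseteq> S"
  shows "monom_eval f m = (\<Prod>v\<in>S. f v ^ Poly_Mapping.lookup m v)"
  unfolding monom_eval_def using assms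
  by (intro prod.mono_neutral_left) (auto simp: in_keys_iff)

lemma monom_eval_add: "monom_eval f (m + n) = monom_eval f m * monom_eval f n"
proof -
  let ?S = "Poly_Mapping.keys m \<union> Poly_Mapping.keys n"
  have sub: "Poly_Mapping.keys (m + n) \<subseteq> ?S" by (rule Poly_Mapping.keys_add)
  show ?thesis
    by (simp add: monom_eval_superset[of ?S] sub lookup_add power_add prod.distrib)
qed

lemma monom_eval_zero [simp]: "monom_eval f 0 = 1"
  by (simp add: monom_eval_def)

lemma monom_eval_single [simp]: "monom_eval f (Poly_Mapping.single v k) = f v ^ k"
  by (cases "k = 0") (auto simp: monom_eval_def)

lemma monom_eval_power:
  fixes f :: "'v \<Rightarrow> 'c::comm_semiring_1"
  shows "monom_eval (\<lambda>v. f v ^ k) m = monom_eval f m ^ k"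
proof -
  have "(f v ^ k) ^ j = (f v ^ j) ^ k" for v j
    by (metis mult.commute power_mult)
  then show ?thesis by (simp add: monom_eval_def prod_power_distrib)
qed

lemma monomial_expansion:
  fixes P :: "'v \<Rightarrow>\<^sub>0 'c::comm_monoid_add"
  shows "P = (\<Sum>m\<in>Poly_Mapping.keys P. Poly_Mapping.single m (Poly_Mapping.lookup P m))"
proof (rule poly_mapping_eqI)
  fix k
  show "Poly_Mapping.lookup P k = Poly_Mapping.lookup
      (\<Sum>m\<in>Poly_Mapping.keys P. Poly_Mapping.single m (Poly_Mapping.lookup P m)) k"
    by (cases "k \<in> Poly_Mapping.keys P")
       (auto simp: lookup_sum lookup_single when_def in_keys_iff)
qed

lemma int_mpoly_induct [case_names monomial add]:
  fixes P :: "'v int_mpoly"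
  assumes "\<And>m c. Q (Poly_Mapping.single m c)" "\<And>a b. Q a \<Longrightarrow> Q b \<Longrightarrow> Q (a + b)"
  shows "Q P"
proof -
  have zero: "Q 0" using assms(1)[of 0 0] by simp
  have "Q (\<Sum>m\<in>S. Poly_Mapping.single m (Poly_Mapping.lookup P m))" if "finite S" for S
    using that by (induction S rule: finite_induct) (auto simp: zero assms)
  from this[of "Poly_Mapping.keys P"] show ?thesis
    by (simp flip: monomial_expansion)
qed

lemma eval_superset:
  assumes "finite S" "Poly_Mapping.keys P \<subseteq> S"
  shows "eval f P = (\<Sum>m\<in>S. of_int (Poly_Mapping.lookup P m) * monom_eval f m)"
  unfolding eval_def monom_eval_def[symmetric] using assms
  by (intro sum.mono_neutral_left) (auto simp: in_keys_iff)

lemma eval_add: "eval f (P + Q) = eval f P + eval f Q"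
proof -
  let ?S = "Poly_Mapping.keys P \<union> Poly_Mapping.keys Q"
  have sub: "Poly_Mapping.keys (P + Q) \<subseteq> ?S" by (rule Poly_Mapping.keys_add)
  show ?thesis
    by (simp add: eval_superset[of ?S] sub lookup_add ring_distribs sum.distrib)
qed

lemma eval_monomial: "eval f (Poly_Mapping.single m c) = of_int c * monom_eval f m"
  by (simp add: eval_superset[of "{m}"])

lemma eval_zero [simp]: "eval f 0 = 0"
  by (simp add: eval_def)

lemma eval_one [simp]: "eval f 1 = 1"
  by (simp add: eval_monomial flip: single_one)

lemma eval_mult: "eval f (P * Q) = eval f P * eval f Q"
proof (induction P rule: int_mpoly_induct)
  case (monomial m c)
  show ?case
    by (induction Q rule: int_mpoly_induct)
       (simp_all add: mult_single eval_monomial monom_eval_add eval_add algebra_simps)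
qed (simp add: eval_add algebra_simps)

lemma eval_uminus: "eval f (- P) = - eval f P"
  using eval_add[of f P "- P"] by (simp add: eq_neg_iff_add_eq_0 add.commute)

lemma eval_diff: "eval f (P - Q) = eval f P - eval f Q"
  using eval_add[of f P "- Q"] by (simp add: eval_uminus)

lemma eval_power: "eval f (P ^ k) = eval f P ^ k"
  by (induction k) (simp_all add: eval_mult)

lemma eval_of_nat [simp]: "eval f (of_nat k) = of_nat k"
  by (induction k) (simp_all add: eval_add)

lemma eval_sum: "eval f (sum g S) = (\<Sum>x\<in>S. eval f (g x))"
  by (induction S rule: infinite_finite_induct) (simp_all add: eval_add)

lemma eval_var [simp]: "eval f (var v) = f v"
  by (simp add: var_def eval_monomial)

lemma eval_of_int [simp]: "eval f (of_int k) = of_int k"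
  by (cases k) (simp_all add: eval_uminus eval_diff)

lemma eval_monom_eval:
  fixes m :: "'w \<Rightarrow>\<^sub>0 nat"
  shows "eval f (monom_eval g m) = monom_eval (\<lambda>v. eval f (g v)) m"
proof -
  have "eval f (\<Prod>v\<in>S. h v) = (\<Prod>v\<in>S. eval f (h v))" for S :: "'w set" and h
    by (induction S rule: infinite_finite_induct) (simp_all add: eval_mult)
  then show ?thesis by (simp add: monom_eval_def eval_power)
qed

lemma eval_eval: "eval f (eval g P) = eval (\<lambda>v. eval f (g v)) P"
  by (induction P rule: int_mpoly_induct)
     (simp_all add: eval_add eval_monomial eval_mult eval_monom_eval)

lemma lookup_of_nat_times:
  "Poly_Mapping.lookup (of_nat k * P) m = int k * Poly_Mapping.lookup P m"
  for P :: "'v int_mpoly"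
  by (induction k) (simp_all add: ring_distribs lookup_add)

lemma of_nat_times_cancel:
  fixes P Q :: "'v int_mpoly"
  assumes "of_nat k * P = of_nat k * Q" "k > 0"
  shows "P = Q"
proof (rule poly_mapping_eqI)
  fix m
  show "Poly_Mapping.lookup P m = Poly_Mapping.lookup Q m"
    using arg_cong[OF assms(1), of "\<lambda>P. Poly_Mapping.lookup P m"] assms(2)
    by (simp add: lookup_of_nat_times)
qed


section \<open>Ghost components and Dwork's lemma\<close>

text \<open>The cofactor of \<open>a - b\<close> in \<open>a\<^sup>p - b\<^sup>p\<close> is a sum of \<open>p\<close> terms that are all congruent to
  \<open>b ^ (p - 1)\<close> modulo \<open>p\<close>, hence a multiple of \<open>p\<close>.\<close>

lemma prime_power_cong_step:
  fixes a b :: "'a::comm_ring_1"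
  assumes "of_nat p ^ Suc k dvd a - b"
  shows "of_nat p ^ Suc (Suc k) dvd a ^ p - b ^ p"
proof -
  have pab: "of_nat p dvd a - b"
    using assms by (meson dvd_power dvd_trans zero_less_Suc)
  have pow: "of_nat p dvd a ^ i - b ^ i" for i
    using pab by (metis dvd_mult2 power_diff_sumr2)
  have "of_nat p dvd (\<Sum>i<p. b ^ (p - Suc i) * a ^ i - b ^ (p - Suc i) * b ^ i)"
    by (intro dvd_sum) (simp add: pow flip: right_diff_distrib)
  moreover have "(\<Sum>i<p. b ^ (p - Suc i) * b ^ i) = of_nat p * b ^ (p - 1)"
    by (simp flip: power_add)
  ultimately have "of_nat p dvd (\<Sum>i<p. b ^ (p - Suc i) * a ^ i)"
    by (simp add: sum_subtractf) (metis dvd_diffD1 dvd_triv_left dvd_diff_commute diff_add_cancel dvd_add)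
  then have "of_nat p ^ Suc k * of_nat p dvd (a - b) * (\<Sum>i<p. b ^ (p - Suc i) * a ^ i)"
    using assms by (rule mult_dvd_mono[rotated])
  then show ?thesis by (simp add: power_diff_sumr2 mult_ac)
qed

lemma prime_power_cong:
  fixes a b :: "'a::comm_ring_1"
  assumes "of_nat p dvd a - b"
  shows "of_nat p ^ Suc k dvd a ^ (p ^ k) - b ^ (p ^ k)"
proof (induction k)
  case (Suc k)
  from prime_power_cong_step[OF Suc] show ?case by (simp add: mult.commute flip: power_mult)
qed (use assms in simp)

lemma ghost_split:
  "ghost p n x = (\<Sum>i<n. of_nat p ^ i * x i ^ (p ^ (n - i))) + of_nat p ^ n * x n"
  by (simp add: ghost_def lessThan_Suc_atMost[symmetric])

lemma ghost_cong: "(\<And>i. i \<le> n \<Longrightarrow> x i = y i) \<Longrightarrow> ghost p n x = ghost p n y"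
  by (simp add: ghost_def)

lemma eval_ghost: "eval f (ghost p n U) = ghost p n (\<lambda>i. eval f (U i))"
  by (simp add: ghost_def eval_sum eval_mult eval_power flip: of_nat_power)

text \<open>Modulo \<open>p ^ (n + 1)\<close>, the lower terms \<open>p\<^sup>i x\<^sub>i ^ (p ^ (n - i))\<close> of the \<open>n\<close>-th ghost component are
  determined by the residues of the \<open>x\<^sub>i\<close> modulo \<open>p\<close>, so that the last term \<open>p\<^sup>n x\<^sub>n\<close> can be
  isolated. This lemma reduces computations in characteristic \<open>p\<close> to ghost components.\<close>

lemma components_cong_if_ghost_cong:
  fixes U V :: "nat \<Rightarrow> 'v int_mpoly"
  assumes "p > 0" and "\<And>n. of_nat p ^ Suc n dvd ghost p n U - ghost p n V"
  shows "of_nat p dvd U n - V n"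
proof (induction n rule: less_induct)
  case (less n)
  have "of_nat p ^ Suc n dvd of_nat p ^ i * U i ^ (p ^ (n - i)) - of_nat p ^ i * V i ^ (p ^ (n - i))"
    if "i < n" for i
  proof -
    have "of_nat p ^ i * of_nat p ^ Suc (n - i) dvd
        of_nat p ^ i * (U i ^ (p ^ (n - i)) - V i ^ (p ^ (n - i)))"
      using prime_power_cong[OF less[OF that]] by (rule mult_dvd_mono[OF dvd_refl])
    moreover have "Suc n = i + Suc (n - i)" using that by simp
    ultimately show ?thesis by (simp only: power_add right_diff_distrib)
  qed
  then have "of_nat p ^ Suc n dvd (\<Sum>i<n. of_nat p ^ i * U i ^ (p ^ (n - i)))
      - (\<Sum>i<n. of_nat p ^ i * V i ^ (p ^ (n - i)))"
    unfolding sum_subtractf[symmetric] by (intro dvd_sum) simp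
  with assms(2)[of n] have "of_nat p ^ Suc n dvd
      (ghost p n U - ghost p n V) - ((\<Sum>i<n. of_nat p ^ i * U i ^ (p ^ (n - i)))
      - (\<Sum>i<n. of_nat p ^ i * V i ^ (p ^ (n - i))))"
    by (rule dvd_diff)
  then have "of_nat p ^ Suc n dvd of_nat p ^ n * (U n - V n)"
    by (simp add: ghost_split algebra_simps)
  then obtain c where "of_nat p ^ n * (U n - V n) = of_nat p ^ Suc n * c" ..
  then have "of_nat (p ^ n) * (U n - V n) = of_nat (p ^ n) * (of_nat p * c)"
    by (simp add: mult_ac)
  then have "U n - V n = of_nat p * c"
    by (rule of_nat_times_cancel) (use assms(1) in simp)
  then show ?case by simp
qed

lemma ghost_inj:
  fixes U V :: "nat \<Rightarrow> 'v int_mpoly"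
  assumes "p > 0" "\<And>i. i \<le> n \<Longrightarrow> ghost p i U = ghost p i V"
  shows "i \<le> n \<Longrightarrow> U i = V i"
proof (induction i rule: less_induct)
  case (less i)
  have lower: "(\<Sum>j<i. of_nat p ^ j * U j ^ (p ^ (i - j))) = (\<Sum>j<i. of_nat p ^ j * V j ^ (p ^ (i - j)))"
    using less by (intro sum.cong) auto
  have "of_nat (p ^ i) * U i = of_nat (p ^ i) * V i"
    using assms(2)[OF less(2)] unfolding ghost_split lower add_left_cancel of_nat_power .
  then show ?case by (rule of_nat_times_cancel) (use assms(1) in simp)
qed

lemma ghost_eqI:
  fixes U V :: "nat \<Rightarrow> 'v int_mpoly"
  assumes "p > 0" "\<And>n. ghost p n U = ghost p n V"
  shows "U = V"
  using ghost_inj[OF assms(1)] assms(2) by blast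

text \<open>Dwork's lemma requires a ring endomorphism that lifts the \<open>p\<close>-power map modulo \<open>p\<close>; on a
  polynomial ring over \<open>\<int>\<close> a substitution does this.\<close>

definition frob_lift :: "nat \<Rightarrow> 'v int_mpoly \<Rightarrow> 'v int_mpoly" where
  "frob_lift p = eval (\<lambda>v. var v ^ p)"

lemma power_prime_add_cong:
  fixes a b :: "'a::comm_ring_1"
  assumes "Factorial_Ring.prime p"
  shows "of_nat p dvd (a + b) ^ p - (a ^ p + b ^ p)"
proof -
  from prime_gt_1_nat[OF assms] obtain q where q: "p = Suc (Suc q)"
    by (metis One_nat_def less_imp_Suc_add add_0 plus_nat.add_Suc)
  have "of_nat p dvd (\<Sum>k=1..<p. of_nat (p choose k) * a ^ k * b ^ (p - k))"
  proof (intro dvd_sum dvd_mult2)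
    fix k assume "k \<in> {1..<p}"
    with assms have "p dvd p choose k" by (intro dvd_choose_prime) auto
    then show "of_nat p dvd (of_nat (p choose k) :: 'a)" by (metis dvd_def of_nat_mult)
  qed
  moreover have "{..p} = insert 0 (insert p {1..<p})" using q by auto
  then have "(a + b) ^ p = b ^ p + (a ^ p + (\<Sum>k=1..<p. of_nat (p choose k) * a ^ k * b ^ (p - k)))"
    using prime_gt_0_nat[OF assms] by (simp add: binomial_ring)
  ultimately show ?thesis by (simp add: algebra_simps)
qed

lemma prime_dvd_diff_power_int:
  assumes p: "Factorial_Ring.prime p"
  shows "int p dvd c - c ^ p"
proof (induction c rule: int_induct[where k = 0])
  case base
  then show ?case using prime_gt_0_nat[OF p] by (simp add: power_0_left)
next
  case (step1 c)
  have "(c + 1) - (c + 1) ^ p = (c - c ^ p) - ((c + 1) ^ p - (c ^ p + 1 ^ p))" by simp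
  with step1 power_prime_add_cong[OF p, of c 1] show ?case by (simp only: dvd_diff)
next
  case (step2 c)
  have "(c - 1) - (c - 1) ^ p = (c - c ^ p) + (((c - 1) + 1) ^ p - ((c - 1) ^ p + 1 ^ p))" by simp
  with step2 power_prime_add_cong[OF p, of "c - 1" 1] show ?case by (simp only: dvd_add)
qed

lemma monom_eval_var:
  fixes m :: "'v \<Rightarrow>\<^sub>0 nat"
  shows "monom_eval var m = Poly_Mapping.single m 1"
proof -
  have pow: "var v ^ k = (Poly_Mapping.single (Poly_Mapping.single v k) 1 :: 'v int_mpoly)"
    for v :: 'v and k
    by (induction k) (simp_all add: var_def mult_single flip: single_add)
  have "(\<Prod>v\<in>S. Poly_Mapping.single (h v) 1) = (Poly_Mapping.single (sum h S) 1 :: 'v int_mpoly)"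
    for S :: "'v set" and h
    by (induction S rule: infinite_finite_induct) (simp_all add: mult_single)
  then show ?thesis
    by (simp add: monom_eval_def pow flip: monomial_expansion)
qed

lemma monomial_eq: "Poly_Mapping.single m c = of_int c * monom_eval var m"
  by (simp add: monom_eval_var mult_single flip: single_of_int)

lemma frob_lift_cong:
  assumes p: "Factorial_Ring.prime p"
  shows "of_nat p dvd frob_lift p P - P ^ p"
proof (induction P rule: int_mpoly_induct)
  case (monomial m c)
  have "int p dvd c - c ^ p" by (rule prime_dvd_diff_power_int[OF p])
  then obtain d where d: "c - c ^ p = int p * d" ..
  have "frob_lift p (Poly_Mapping.single m c) - Poly_Mapping.single m c ^ p
      = of_int (c - c ^ p) * monom_eval var m ^ p"
    by (simp add: frob_lift_def eval_mult eval_monom_eval monom_eval_power monomial_eq[of m c]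
        power_mult_distrib algebra_simps)
  then show ?case by (simp add: d mult.assoc)
next
  case (add a b)
  have "frob_lift p (a + b) - (a + b) ^ p = (frob_lift p a - a ^ p) + (frob_lift p b - b ^ p)
      - ((a + b) ^ p - (a ^ p + b ^ p))"
    by (simp add: frob_lift_def eval_add)
  with add power_prime_add_cong[OF p, of a b] show ?case
    by (simp only: dvd_add dvd_diff)
qed

definition ghost_congruences :: "nat \<Rightarrow> (nat \<Rightarrow> 'v int_mpoly) \<Rightarrow> bool" where
  "ghost_congruences p w \<longleftrightarrow> (\<forall>n. of_nat p ^ Suc n dvd w (Suc n) - frob_lift p (w n))"

text \<open>Both directions of Dwork's lemma rest on this: the congruence modulo \<open>p\<close> between \<open>x\<^sub>i\<^sup>p\<close> and the image of
  \<open>x\<^sub>i\<close> gains \<open>n - i\<close> factors \<open>p\<close> from the \<open>p ^ (n - i)\<close>-th power, and the coefficient provides \<open>i\<close> more.\<close>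

lemma frob_lift_ghost_cong:
  assumes "Factorial_Ring.prime p"
  shows "of_nat p ^ Suc n dvd (\<Sum>i\<le>n. of_nat p ^ i * x i ^ (p ^ (Suc n - i))) - frob_lift p (ghost p n x)"
proof -
  have "of_nat p ^ Suc n dvd
      of_nat p ^ i * x i ^ (p ^ (Suc n - i)) - of_nat p ^ i * frob_lift p (x i) ^ (p ^ (n - i))"
    if "i \<le> n" for i
  proof -
    have "of_nat p dvd x i ^ p - frob_lift p (x i)"
      using frob_lift_cong[OF assms, of "x i"] by (metis dvd_minus_iff minus_diff_eq)
    from prime_power_cong[OF this, of "n - i"]
    have "of_nat p ^ i * of_nat p ^ Suc (n - i) dvd
        of_nat p ^ i * ((x i ^ p) ^ (p ^ (n - i)) - frob_lift p (x i) ^ (p ^ (n - i)))"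
      by (rule mult_dvd_mono[OF dvd_refl])
    moreover have "(x i ^ p) ^ (p ^ (n - i)) = x i ^ (p ^ (Suc n - i))"
      using that by (simp add: Suc_diff_le flip: power_mult)
    moreover have "Suc n = i + Suc (n - i)" using that by simp
    ultimately show ?thesis by (metis power_add right_diff_distrib)
  qed
  then have "of_nat p ^ Suc n dvd (\<Sum>i\<le>n. of_nat p ^ i * x i ^ (p ^ (Suc n - i))
      - of_nat p ^ i * frob_lift p (x i) ^ (p ^ (n - i)))"
    by (intro dvd_sum) simp
  moreover have "frob_lift p (ghost p n x) = (\<Sum>i\<le>n. of_nat p ^ i * frob_lift p (x i) ^ (p ^ (n - i)))"
    unfolding frob_lift_def eval_ghost by (simp add: ghost_def)
  ultimately show ?thesis by (simp only: sum_subtractf)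
qed

lemma ghost_congruences_ghost:
  assumes "Factorial_Ring.prime p"
  shows "ghost_congruences p (\<lambda>n. ghost p n x)"
  unfolding ghost_congruences_def
proof
  fix n
  have "ghost p (Suc n) x - frob_lift p (ghost p n x)
      = ((\<Sum>i\<le>n. of_nat p ^ i * x i ^ (p ^ (Suc n - i))) - frob_lift p (ghost p n x))
        + of_nat p ^ Suc n * x (Suc n)"
    by (simp add: ghost_def)
  with frob_lift_ghost_cong[OF assms, of n x]
  show "of_nat p ^ Suc n dvd ghost p (Suc n) x - frob_lift p (ghost p n x)"
    by (simp only: dvd_add dvd_triv_left)
qed

text \<open>Dwork's lemma. Once \<open>x\<^sub>0, \<dots>, x\<^sub>n\<close> are found, the congruence between \<open>w\<^sub>n\<^sub>+\<^sub>1\<close> and the image of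
  \<open>w\<^sub>n\<close> gives the divisibility by \<open>p ^ (n + 1)\<close> that is required to solve for \<open>x\<^sub>n\<^sub>+\<^sub>1\<close>.
  Uniqueness holds because the polynomial ring is torsion-free. Since sequences with these
  congruences form a ring, stable under shifts, all the universal polynomials exist.\<close>

lemma dwork:
  fixes w :: "nat \<Rightarrow> 'v int_mpoly"
  assumes p: "Factorial_Ring.prime p" and w: "ghost_congruences p w"
  shows "\<exists>!x. \<forall>n. ghost p n x = w n"
proof -
  have pos: "p > 0" using p by (rule prime_gt_0_nat)
  have "\<exists>x. \<forall>i\<le>n. ghost p i x = w i" for n
  proof (induction n)
    case 0
    have "ghost p 0 (\<lambda>_. w 0) = w 0" by (simp add: ghost_def)
    then show ?case by (intro exI[of _ "\<lambda>_. w 0"]) simp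
  next
    case (Suc n)
    then obtain x where x: "\<And>i. i \<le> n \<Longrightarrow> ghost p i x = w i" by blast
    let ?s = "\<Sum>i\<le>n. of_nat p ^ i * x i ^ (p ^ (Suc n - i))"
    have "of_nat p ^ Suc n dvd w (Suc n) - frob_lift p (w n)"
      using w by (simp only: ghost_congruences_def)
    moreover have "of_nat p ^ Suc n dvd ?s - frob_lift p (w n)"
      using frob_lift_ghost_cong[OF p, of n x] x[of n] by simp
    ultimately have "of_nat p ^ Suc n dvd (w (Suc n) - frob_lift p (w n)) - (?s - frob_lift p (w n))"
      by (rule dvd_diff)
    then have "of_nat p ^ Suc n dvd w (Suc n) - ?s" by (simp only: diff_diff_eq2 diff_add_cancel)
    then obtain a where a: "w (Suc n) - ?s = of_nat p ^ Suc n * a" ..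
    have "ghost p (Suc n) (x(Suc n := a)) = ?s + of_nat p ^ Suc n * a"
      by (simp add: ghost_def)
    also have "\<dots> = w (Suc n)" by (simp only: flip: a) simp
    finally have "ghost p (Suc n) (x(Suc n := a)) = w (Suc n)" .
    moreover have "ghost p i (x(Suc n := a)) = w i" if "i \<le> n" for i
      using x[OF that] that by (subst ghost_cong[of i _ x]) auto
    ultimately show ?case by (intro exI[of _ "x(Suc n := a)"]) (auto simp: le_Suc_eq simp del: fun_upd_apply)
  qed
  then obtain x where x: "\<And>n i. i \<le> n \<Longrightarrow> ghost p i (x n) = w i" by metis
  have agree: "x n i = x i i" if "i \<le> n" for n i
    by (rule ghost_inj[OF pos, of i "x n" "x i"]) (simp_all add: x order_trans[OF _ that])
  have "ghost p n (\<lambda>i. x i i) = w n" for n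
    using ghost_cong[where x = "\<lambda>i. x i i" and y = "x n" and n = n and p = p] agree[of _ n] x[of n n]
    by simp
  then show ?thesis
    by (intro ex1I[of _ "\<lambda>i. x i i"]) (auto intro!: ghost_eqI[OF pos])
qed

lemma ghost_congruences_add:
  assumes "ghost_congruences p v" "ghost_congruences p w"
  shows "ghost_congruences p (\<lambda>n. v n + w n)"
  unfolding ghost_congruences_def
proof
  fix n
  have "v (Suc n) + w (Suc n) - frob_lift p (v n + w n)
      = (v (Suc n) - frob_lift p (v n)) + (w (Suc n) - frob_lift p (w n))"
    by (simp add: frob_lift_def eval_add)
  with assms show "of_nat p ^ Suc n dvd v (Suc n) + w (Suc n) - frob_lift p (v n + w n)"
    by (simp only: ghost_congruences_def dvd_add)
qed

lemma ghost_congruences_mult: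
  assumes "ghost_congruences p v" "ghost_congruences p w"
  shows "ghost_congruences p (\<lambda>n. v n * w n)"
  unfolding ghost_congruences_def
proof
  fix n
  have "v (Suc n) * w (Suc n) - frob_lift p (v n * w n)
      = (v (Suc n) - frob_lift p (v n)) * w (Suc n) + frob_lift p (v n) * (w (Suc n) - frob_lift p (w n))"
    by (simp add: frob_lift_def eval_mult algebra_simps)
  with assms show "of_nat p ^ Suc n dvd v (Suc n) * w (Suc n) - frob_lift p (v n * w n)"
    by (simp only: ghost_congruences_def dvd_add dvd_mult dvd_mult2)
qed

lemma ghost_congruences_uminus:
  assumes "ghost_congruences p w"
  shows "ghost_congruences p (\<lambda>n. - w n)"
  unfolding ghost_congruences_def
proof
  fix n
  have "- w (Suc n) - frob_lift p (- w n) = - (w (Suc n) - frob_lift p (w n))"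
    by (simp add: frob_lift_def eval_uminus)
  with assms show "of_nat p ^ Suc n dvd - w (Suc n) - frob_lift p (- w n)"
    by (simp only: ghost_congruences_def dvd_minus_iff)
qed

lemma ghost_congruences_Suc:
  assumes "ghost_congruences p w"
  shows "ghost_congruences p (\<lambda>n. w (Suc n))"
  using assms unfolding ghost_congruences_def by (metis dvd_mult_right power_Suc)


section \<open>The ring of Witt vectors\<close>

text \<open>Negation is not component-wise when \<open>p = 2\<close>, so it has universal polynomials of its own.\<close>

definition witt_neg_poly :: "nat \<Rightarrow> nat \<Rightarrow> nat int_mpoly" where
  "witt_neg_poly p = (THE S. \<forall>n. ghost p n S = - ghost p n var)"

definition witt_neg :: "nat \<Rightarrow> (nat \<Rightarrow> 'a::comm_ring_1) \<Rightarrow> nat \<Rightarrow> 'a" where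
  "witt_neg p x n = eval x (witt_neg_poly p n)"

text \<open>Every ring is a quotient of a polynomial ring over \<open>\<int>\<close>, with one variable for every element;
  there, ghost components determine a Witt vector, and identities can be checked on them. Zero is
  lifted to zero so that the lift of a Witt vector has the same support.\<close>

definition lift :: "'a::comm_ring_1 \<Rightarrow> 'a int_mpoly" where
  "lift a = (if a = 0 then 0 else var a)"

abbreviation lift_vec :: "(nat \<Rightarrow> 'a::comm_ring_1) \<Rightarrow> nat \<Rightarrow> 'a int_mpoly" where
  "lift_vec x \<equiv> \<lambda>i. lift (x i)"

lemma eval_lift [simp]: "eval id (lift a) = a"
  by (simp add: lift_def)

lemma eval_case_sum: "(\<lambda>v. eval f (case_sum x y v)) = case_sum (\<lambda>i. eval f (x i)) (\<lambda>i. eval f (y i))"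
  by (auto split: sum.splits)

lemma eval_witt_add: "eval f (witt_add p x y n) = witt_add p (\<lambda>i. eval f (x i)) (\<lambda>i. eval f (y i)) n"
  by (simp add: witt_add_def eval_eval eval_case_sum)

lemma eval_witt_mult: "eval f (witt_mult p x y n) = witt_mult p (\<lambda>i. eval f (x i)) (\<lambda>i. eval f (y i)) n"
  by (simp add: witt_mult_def eval_eval eval_case_sum)

lemma eval_witt_neg: "eval f (witt_neg p x n) = witt_neg p (\<lambda>i. eval f (x i)) n"
  by (simp add: witt_neg_def eval_eval)

lemma eval_witt_frob: "eval f (witt_frob p x n) = witt_frob p (\<lambda>i. eval f (x i)) n"
  by (simp add: witt_frob_def eval_eval)

lemma eval_witt_zero: "eval f (witt_zero n) = witt_zero n"
  by (simp add: witt_zero_def)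

lemma eval_witt_one: "eval f (witt_one n) = witt_one n"
  by (simp add: witt_one_def)

lemmas eval_witt = eval_witt_add eval_witt_mult eval_witt_neg eval_witt_frob
  eval_witt_zero eval_witt_one

lemma witt_identity_transfer:
  assumes "u = u'" "\<And>i. eval id (u i) = x i" "\<And>i. eval id (u' i) = x' i"
  shows "x = x'"
  using assms by (metis ext)

context
  fixes p :: nat
  assumes p: "Factorial_Ring.prime p"
begin

lemma ghost_witt_add: "ghost p n (witt_add p x y) = ghost p n x + ghost p n y"
proof -
  have "\<forall>n. ghost p n (witt_add_poly p) = ghost p n (\<lambda>i. var (Inl i)) + ghost p n (\<lambda>i. var (Inr i))"
    unfolding witt_add_poly_def
    by (rule theI'[OF dwork[OF p ghost_congruences_add[OF ghost_congruences_ghost[OF p] ghost_congruences_ghost[OF p]]]])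
  then have "eval (case_sum x y) (ghost p n (witt_add_poly p))
      = eval (case_sum x y) (ghost p n (\<lambda>i. var (Inl i)) + ghost p n (\<lambda>i. var (Inr i)))" by simp
  then show ?thesis by (simp add: eval_add eval_ghost flip: witt_add_def)
qed

lemma ghost_witt_mult: "ghost p n (witt_mult p x y) = ghost p n x * ghost p n y"
proof -
  have "\<forall>n. ghost p n (witt_mult_poly p) = ghost p n (\<lambda>i. var (Inl i)) * ghost p n (\<lambda>i. var (Inr i))"
    unfolding witt_mult_poly_def
    by (rule theI'[OF dwork[OF p ghost_congruences_mult[OF ghost_congruences_ghost[OF p] ghost_congruences_ghost[OF p]]]])
  then have "eval (case_sum x y) (ghost p n (witt_mult_poly p))
      = eval (case_sum x y) (ghost p n (\<lambda>i. var (Inl i)) * ghost p n (\<lambda>i. var (Inr i)))" by simp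
  then show ?thesis by (simp add: eval_mult eval_ghost flip: witt_mult_def)
qed

lemma ghost_witt_neg: "ghost p n (witt_neg p x) = - ghost p n x"
proof -
  have "\<forall>n. ghost p n (witt_neg_poly p) = - ghost p n var"
    unfolding witt_neg_poly_def
    by (rule theI'[OF dwork[OF p ghost_congruences_uminus[OF ghost_congruences_ghost[OF p]]]])
  then have "eval x (ghost p n (witt_neg_poly p)) = eval x (- ghost p n var)" by simp
  then show ?thesis by (simp add: eval_uminus eval_ghost flip: witt_neg_def)
qed

lemma ghost_witt_frob: "ghost p n (witt_frob p x) = ghost p (Suc n) x"
proof -
  have "\<forall>n. ghost p n (witt_frob_poly p) = ghost p (Suc n) var"
    unfolding witt_frob_poly_def
    by (rule theI'[OF dwork[OF p ghost_congruences_Suc[OF ghost_congruences_ghost[OF p]]]])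
  then have "eval x (ghost p n (witt_frob_poly p)) = eval x (ghost p (Suc n) var)" by simp
  then show ?thesis by (simp add: eval_ghost flip: witt_frob_def)
qed

lemma ghost_witt_zero: "ghost p n witt_zero = 0"
  using prime_gt_0_nat[OF p] by (simp add: ghost_def witt_zero_def power_0_left)

lemma ghost_witt_one: "ghost p n witt_one = 1"
proof -
  have "ghost p n witt_one = (\<Sum>i\<le>n. if i = 0 then 1 else 0)"
    unfolding ghost_def using prime_gt_0_nat[OF p]
    by (intro sum.cong) (auto simp: witt_one_def power_0_left)
  then show ?thesis by simp
qed

lemmas ghost_witt = ghost_witt_add ghost_witt_mult ghost_witt_neg ghost_witt_frob
  ghost_witt_zero ghost_witt_one

lemmas witt_ghost_eqI = ghost_eqI[OF prime_gt_0_nat[OF p]]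

lemma witt_add_assoc: "witt_add p (witt_add p x y) z = witt_add p x (witt_add p y z)"
  by (rule witt_identity_transfer[where
        u = "witt_add p (witt_add p (lift_vec x) (lift_vec y)) (lift_vec z)" and
        u' = "witt_add p (lift_vec x) (witt_add p (lift_vec y) (lift_vec z))", OF witt_ghost_eqI])
     (simp_all add: ghost_witt eval_witt add.assoc)

lemma witt_add_commute: "witt_add p x y = witt_add p y x"
  by (rule witt_identity_transfer[where
        u = "witt_add p (lift_vec x) (lift_vec y)" and
        u' = "witt_add p (lift_vec y) (lift_vec x)", OF witt_ghost_eqI])
     (simp_all add: ghost_witt eval_witt add.commute)

lemma witt_add_zero: "witt_add p witt_zero x = x"
  by (rule witt_identity_transfer[where
        u = "witt_add p witt_zero (lift_vec x)" and u' = "lift_vec x", OF witt_ghost_eqI])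
     (simp_all add: ghost_witt eval_witt)

lemma witt_add_neg: "witt_add p (witt_neg p x) x = witt_zero"
  by (rule witt_identity_transfer[where
        u = "witt_add p (witt_neg p (lift_vec x)) (lift_vec x)" and u' = witt_zero,
        OF witt_ghost_eqI])
     (simp_all add: ghost_witt eval_witt)

lemma witt_mult_assoc: "witt_mult p (witt_mult p x y) z = witt_mult p x (witt_mult p y z)"
  by (rule witt_identity_transfer[where
        u = "witt_mult p (witt_mult p (lift_vec x) (lift_vec y)) (lift_vec z)" and
        u' = "witt_mult p (lift_vec x) (witt_mult p (lift_vec y) (lift_vec z))", OF witt_ghost_eqI])
     (simp_all add: ghost_witt eval_witt mult.assoc)

lemma witt_mult_commute: "witt_mult p x y = witt_mult p y x"
  by (rule witt_identity_transfer[where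
        u = "witt_mult p (lift_vec x) (lift_vec y)" and
        u' = "witt_mult p (lift_vec y) (lift_vec x)", OF witt_ghost_eqI])
     (simp_all add: ghost_witt eval_witt mult.commute)

lemma witt_mult_one: "witt_mult p witt_one x = x"
  by (rule witt_identity_transfer[where
        u = "witt_mult p witt_one (lift_vec x)" and u' = "lift_vec x", OF witt_ghost_eqI])
     (simp_all add: ghost_witt eval_witt)

lemma witt_mult_zero: "witt_mult p witt_zero x = witt_zero"
  by (rule witt_identity_transfer[where
        u = "witt_mult p witt_zero (lift_vec x)" and u' = witt_zero, OF witt_ghost_eqI])
     (simp_all add: ghost_witt eval_witt)

lemma witt_distrib:
  "witt_mult p (witt_add p x y) z = witt_add p (witt_mult p x z) (witt_mult p y z)"
  by (rule witt_identity_transfer[where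
        u = "witt_mult p (witt_add p (lift_vec x) (lift_vec y)) (lift_vec z)" and
        u' = "witt_add p (witt_mult p (lift_vec x) (lift_vec z)) (witt_mult p (lift_vec y) (lift_vec z))",
        OF witt_ghost_eqI])
     (simp_all add: ghost_witt eval_witt ring_distribs)

lemma witt_distrib_left:
  "witt_mult p z (witt_add p x y) = witt_add p (witt_mult p z x) (witt_mult p z y)"
  using witt_distrib[of x y z] by (simp only: witt_mult_commute[of z])

lemma witt_frob_add: "witt_frob p (witt_add p x y) = witt_add p (witt_frob p x) (witt_frob p y)"
  by (rule witt_identity_transfer[where
        u = "witt_frob p (witt_add p (lift_vec x) (lift_vec y))" and
        u' = "witt_add p (witt_frob p (lift_vec x)) (witt_frob p (lift_vec y))", OF witt_ghost_eqI])
     (simp_all add: ghost_witt eval_witt)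

lemma witt_frob_mult: "witt_frob p (witt_mult p x y) = witt_mult p (witt_frob p x) (witt_frob p y)"
  by (rule witt_identity_transfer[where
        u = "witt_frob p (witt_mult p (lift_vec x) (lift_vec y))" and
        u' = "witt_mult p (witt_frob p (lift_vec x)) (witt_frob p (lift_vec y))", OF witt_ghost_eqI])
     (simp_all add: ghost_witt eval_witt)

text \<open>Allows to write a Witt vector as the sum of its components \<open>V\<^sup>i[x\<^sub>i]\<close>: when the supports are disjoint,
  every power in the ghost components splits as a sum.\<close>

lemma witt_add_disjoint:
  assumes "\<And>i. x i = 0 \<or> y i = 0"
  shows "witt_add p x y = (\<lambda>i. x i + y i)"
proof (rule witt_identity_transfer[where
      u = "witt_add p (lift_vec x) (lift_vec y)" and u' = "\<lambda>i. lift (x i) + lift (y i)",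
      OF witt_ghost_eqI])
  fix n
  have "(lift (x i) + lift (y i)) ^ (p ^ k) = lift (x i) ^ (p ^ k) + lift (y i) ^ (p ^ k)" for i k
    using assms[of i] prime_gt_0_nat[OF p] by (auto simp: lift_def power_0_left)
  then show "ghost p n (witt_add p (lift_vec x) (lift_vec y)) = ghost p n (\<lambda>i. lift (x i) + lift (y i))"
    by (simp add: ghost_witt) (simp add: ghost_def ring_distribs sum.distrib)
qed (simp_all add: eval_witt eval_add)

text \<open>The truncated rings inherit their operations because degree \<open>n\<close> of a sum or product depends on
  the ghost components up to \<open>n\<close> alone.\<close>

lemma witt_add_local:
  assumes "\<And>i. i \<le> n \<Longrightarrow> x i = x' i" "\<And>i. i \<le> n \<Longrightarrow> y i = y' i"
  shows "witt_add p x y n = witt_add p x' y' n"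
proof -
  have "witt_add p (lift_vec x) (lift_vec y) n = witt_add p (lift_vec x') (lift_vec y') n"
  proof (rule ghost_inj[OF prime_gt_0_nat[OF p], of n])
    fix i assume i: "i \<le> n"
    have "ghost p i (lift_vec x) = ghost p i (lift_vec x')" "ghost p i (lift_vec y) = ghost p i (lift_vec y')"
      using assms i by (auto intro!: ghost_cong)
    then show "ghost p i (witt_add p (lift_vec x) (lift_vec y))
        = ghost p i (witt_add p (lift_vec x') (lift_vec y'))"
      by (simp add: ghost_witt)
  qed simp
  from arg_cong[OF this, of "eval id"] show ?thesis by (simp add: eval_witt)
qed

lemma witt_mult_local:
  assumes "\<And>i. i \<le> n \<Longrightarrow> x i = x' i" "\<And>i. i \<le> n \<Longrightarrow> y i = y' i"
  shows "witt_mult p x y n = witt_mult p x' y' n"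
proof -
  have "witt_mult p (lift_vec x) (lift_vec y) n = witt_mult p (lift_vec x') (lift_vec y') n"
  proof (rule ghost_inj[OF prime_gt_0_nat[OF p], of n])
    fix i assume i: "i \<le> n"
    have "ghost p i (lift_vec x) = ghost p i (lift_vec x')" "ghost p i (lift_vec y) = ghost p i (lift_vec y')"
      using assms i by (auto intro!: ghost_cong)
    then show "ghost p i (witt_mult p (lift_vec x) (lift_vec y))
        = ghost p i (witt_mult p (lift_vec x') (lift_vec y'))"
      by (simp add: ghost_witt)
  qed simp
  from arg_cong[OF this, of "eval id"] show ?thesis by (simp add: eval_witt)
qed

lemma ring_witt_ring: "ring (witt_ring p :: (nat \<Rightarrow> 'a::comm_ring_1) ring)"
proof (rule ringI)
  let ?W = "witt_ring p :: (nat \<Rightarrow> 'a) ring"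
  have "\<exists>y. witt_add p y x = witt_zero" for x :: "nat \<Rightarrow> 'a"
    using witt_add_neg by blast
  then show "abelian_group ?W"
    by (intro abelian_groupI)
       (auto simp: witt_ring_def witt_add_assoc witt_add_zero intro: witt_add_commute)
  show "monoid ?W"
    by (rule monoidI)
       (auto simp: witt_ring_def witt_mult_assoc witt_mult_one witt_mult_commute[of _ witt_one])
qed (simp_all add: witt_ring_def witt_distrib witt_distrib_left)

lemma witt_ring_a_inv: "\<ominus>\<^bsub>witt_ring p\<^esub> x = witt_neg p (x :: nat \<Rightarrow> 'a::comm_ring_1)"
proof -
  interpret ring "witt_ring p :: (nat \<Rightarrow> 'a) ring" by (rule ring_witt_ring)
  have "witt_neg p x \<oplus>\<^bsub>witt_ring p\<^esub> x = \<zero>\<^bsub>witt_ring p\<^esub>"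
    by (simp add: witt_ring_def witt_add_neg)
  then show ?thesis by (rule minus_equality) (simp_all add: witt_ring_def)
qed

end

section \<open>Witt vectors in characteristic p\<close>

text \<open>The Witt vector \<open>V\<^sup>i[a]\<close>.\<close>

definition witt_single :: "nat \<Rightarrow> 'a::comm_ring_1 \<Rightarrow> nat \<Rightarrow> 'a" where
  "witt_single i a n = (if n = i then a else 0)"

context
  fixes p :: nat
  assumes p: "Factorial_Ring.prime p" and char: "CHAR('a::comm_ring_1) = p"
begin

lemma eval_eqI:
  fixes f :: "'v \<Rightarrow> 'a"
  assumes "of_nat p dvd P - Q"
  shows "eval f P = eval f Q"
proof -
  from assms obtain c where "P - Q = of_nat p * c" ..
  then have "eval f P - eval f Q = of_nat p * eval f c"
    by (metis eval_diff eval_mult eval_of_nat)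
  then show ?thesis using of_nat_CHAR[where 'a = 'a] char by simp
qed

text \<open>In general \<open>w\<^sub>n(F x) = w\<^sub>n((x\<^sub>i\<^sup>p)\<^sub>i) + p ^ (n + 1) x\<^sub>n\<^sub>+\<^sub>1\<close>, and the last term
  vanishes modulo \<open>p ^ (n + 1)\<close>.\<close>

lemma witt_frob_eq_power: "witt_frob p x n = (x n :: 'a) ^ p"
proof -
  let ?U = "lift_vec x"
  have "ghost p k (witt_frob p ?U) - ghost p k (\<lambda>i. ?U i ^ p) = of_nat p ^ Suc k * ?U (Suc k)" for k
  proof -
    have "(?U i ^ p) ^ (p ^ (k - i)) = ?U i ^ (p ^ (Suc k - i))" if "i \<le> k" for i
      using that by (simp add: Suc_diff_le flip: power_mult)
    then show ?thesis by (simp add: ghost_witt_frob[OF p]) (simp add: ghost_def)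
  qed
  then have "of_nat p dvd witt_frob p ?U n - ?U n ^ p"
    by (intro components_cong_if_ghost_cong[OF prime_gt_0_nat[OF p],
          where U = "witt_frob p ?U" and V = "\<lambda>i. ?U i ^ p"]) (simp only: dvd_triv_left)
  from eval_eqI[OF this, of id] show ?thesis by (simp add: eval_witt eval_power)
qed

lemma ghost_witt_single:
  "ghost p n (witt_single i a) = (if i \<le> n then of_nat p ^ i * a ^ (p ^ (n - i)) else 0)"
proof -
  have "ghost p n (witt_single i a) = (\<Sum>j\<le>n. if j = i then of_nat p ^ i * a ^ (p ^ (n - i)) else 0)"
    unfolding ghost_def using prime_gt_0_nat[OF p]
    by (intro sum.cong) (auto simp: witt_single_def power_0_left)
  then show ?thesis by simp
qed

text \<open>The ghost components of both sides agree from index \<open>i + j\<close> on. Those of the left-hand side already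
  start at \<open>max i j\<close>, but as they are multiples of \<open>p\<^sup>i\<^sup>+\<^sup>j\<close>, the ones of index \<open>k < i + j\<close> vanish
  modulo \<open>p ^ (k + 1)\<close>.\<close>

lemma witt_mult_single:
  "witt_mult p (witt_single i a) (witt_single j b)
    = witt_single (i + j) ((a::'a) ^ (p ^ j) * b ^ (p ^ i))"
proof
  fix n
  let ?L = "witt_mult p (witt_single i (lift a)) (witt_single j (lift b))"
  let ?R = "witt_single (i + j) (lift a ^ (p ^ j) * lift b ^ (p ^ i))"
  have "of_nat p ^ Suc k dvd ghost p k ?L - ghost p k ?R" for k
  proof (cases "i + j \<le> k")
    case True
    then have "p ^ j * p ^ (k - (i + j)) = p ^ (k - i)" "p ^ i * p ^ (k - (i + j)) = p ^ (k - j)"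
      by (simp_all flip: power_add)
    then have "(lift a ^ (p ^ j) * lift b ^ (p ^ i)) ^ (p ^ (k - (i + j)))
        = lift a ^ (p ^ (k - i)) * lift b ^ (p ^ (k - j))"
      by (simp add: power_mult_distrib flip: power_mult)
    with True have "ghost p k ?L = ghost p k ?R"
      by (simp add: ghost_witt_mult[OF p] ghost_witt_single power_add mult_ac)
    then show ?thesis by simp
  next
    case False
    have "ghost p k ?L = 0 \<or>
        ghost p k ?L = of_nat p ^ (i + j) * (lift a ^ (p ^ (k - i)) * lift b ^ (p ^ (k - j)))"
      by (simp add: ghost_witt_mult[OF p] ghost_witt_single power_add mult_ac)
    moreover have "of_nat p ^ Suc k dvd (of_nat p ^ (i + j) :: 'a int_mpoly)"
      using False by (intro le_imp_power_dvd) simp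
    ultimately have "of_nat p ^ Suc k dvd ghost p k ?L" by (auto intro: dvd_mult2)
    moreover have "ghost p k ?R = 0" using False by (simp add: ghost_witt_single)
    ultimately show ?thesis by simp
  qed
  then have "of_nat p dvd ?L n - ?R n"
    by (intro components_cong_if_ghost_cong[OF prime_gt_0_nat[OF p], where U = ?L and V = ?R])
  from eval_eqI[OF this, of id]
  have "eval id (?L n) = eval id (?R n)" .
  moreover have single: "(\<lambda>k. eval id (witt_single m c k)) = witt_single m (eval id c)"
    for m and c :: "'a int_mpoly"
    by (auto simp: witt_single_def)
  ultimately show "witt_mult p (witt_single i a) (witt_single j b) n
      = witt_single (i + j) (a ^ (p ^ j) * b ^ (p ^ i)) n"
    using fun_cong[OF single, of "i + j" "lift a ^ (p ^ j) * lift b ^ (p ^ i)" n]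
    by (simp add: eval_witt single eval_mult eval_power)
qed

end

section \<open>The isomorphism with the inverse limit\<close>

lemma witt_trunc_le [simp]: "i \<le> n \<Longrightarrow> witt_trunc n x i = x i"
  by (simp add: witt_trunc_def)

lemma witt_trunc_cong: "(\<And>i. i \<le> n \<Longrightarrow> x i = y i) \<Longrightarrow> witt_trunc n x = witt_trunc n y"
  by (auto simp: witt_trunc_def restrict_def)

context
  fixes p :: nat
  assumes p: "Factorial_Ring.prime p" and char: "CHAR('a::comm_ring_1) = p"
    and perfect: "bij (\<lambda>a::'a. a ^ p)"
begin

abbreviation frob_root :: "nat \<Rightarrow> (nat \<Rightarrow> 'a) \<Rightarrow> nat \<Rightarrow> 'a" where
  "frob_root n \<equiv> inv_into UNIV (witt_frob p) ^^ n"

lemma power_p_power_eq_iff: "(a::'a) ^ (p ^ n) = b ^ (p ^ n) \<longleftrightarrow> a = b"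
proof (induction n)
  case (Suc n)
  have "(a ^ (p ^ n)) ^ p = (b ^ (p ^ n)) ^ p \<longleftrightarrow> a ^ (p ^ n) = b ^ (p ^ n)"
    using inj_eq[OF bij_is_inj[OF perfect], of "a ^ (p ^ n)" "b ^ (p ^ n)"] by simp
  with Suc show ?case unfolding power_Suc2 power_mult by simp
qed simp

lemma bij_witt_frob: "bij (witt_frob p :: (nat \<Rightarrow> 'a) \<Rightarrow> nat \<Rightarrow> 'a)"
proof -
  have frob: "witt_frob p x = (\<lambda>i. x i ^ p)" for x :: "nat \<Rightarrow> 'a"
    by (rule ext) (rule witt_frob_eq_power[OF p char])
  show ?thesis
  proof (rule bijI)
    show "inj (witt_frob p :: (nat \<Rightarrow> 'a) \<Rightarrow> nat \<Rightarrow> 'a)"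
      using power_p_power_eq_iff[of _ 1] by (auto intro!: injI simp: frob fun_eq_iff)
    show "surj (witt_frob p :: (nat \<Rightarrow> 'a) \<Rightarrow> nat \<Rightarrow> 'a)"
    proof (rule surjI)
      fix x :: "nat \<Rightarrow> 'a"
      show "witt_frob p (\<lambda>i. inv_into UNIV (\<lambda>a. a ^ p) (x i)) = x"
        by (simp add: frob surj_f_inv_f[OF bij_is_surj[OF perfect]])
    qed
  qed
qed

lemma frob_frob_root: "(witt_frob p ^^ n) (frob_root n x) = x"
  by (simp add: surj_f_inv_f bij_is_surj bij_fn bij_witt_frob flip: inv_fn)

lemma frob_root_eqI: "(witt_frob p ^^ n) y = x \<Longrightarrow> frob_root n x = y"
  by (metis bij_fn bij_is_inj bij_witt_frob inv_f_f inv_fn)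

lemma frob_iterate: "(witt_frob p ^^ n) x i = (x i :: 'a) ^ (p ^ n)"
  by (induction n) (simp_all add: witt_frob_eq_power[OF p char] mult.commute flip: power_mult)

lemma frob_root_power: "frob_root n x i ^ (p ^ n) = x i"
  by (metis frob_frob_root frob_iterate)

lemma frob_root_unique: "a ^ (p ^ n) = x i \<Longrightarrow> frob_root n x i = a"
  by (metis frob_root_power power_p_power_eq_iff)

lemma frob_root_add: "frob_root n (witt_add p x y) = witt_add p (frob_root n x) (frob_root n y)"
proof (rule frob_root_eqI)
  have "(witt_frob p ^^ n) (witt_add p u v) = witt_add p ((witt_frob p ^^ n) u) ((witt_frob p ^^ n) v)"
    for u v :: "nat \<Rightarrow> 'a"
    by (induction n) (simp_all add: witt_frob_add[OF p])
  then show "(witt_frob p ^^ n) (witt_add p (frob_root n x) (frob_root n y)) = witt_add p x y"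
    by (simp add: frob_frob_root)
qed

lemma frob_root_mult: "frob_root n (witt_mult p x y) = witt_mult p (frob_root n x) (frob_root n y)"
proof (rule frob_root_eqI)
  have "(witt_frob p ^^ n) (witt_mult p u v) = witt_mult p ((witt_frob p ^^ n) u) ((witt_frob p ^^ n) v)"
    for u v :: "nat \<Rightarrow> 'a"
    by (induction n) (simp_all add: witt_frob_mult[OF p])
  then show "(witt_frob p ^^ n) (witt_mult p (frob_root n x) (frob_root n y)) = witt_mult p x y"
    by (simp add: frob_frob_root)
qed

lemma frob_root_one: "frob_root n witt_one = witt_one"
  using prime_gt_0_nat[OF p]
  by (intro ext frob_root_unique) (simp add: witt_one_def power_0_left)

lemma frob_root_zero: "frob_root n witt_zero = witt_zero"
  using prime_gt_0_nat[OF p]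
  by (intro ext frob_root_unique) (simp add: witt_zero_def power_0_left)

lemma invlim_carrier_iff:
  "y \<in> carrier (invlim_witt_ring p) \<longleftrightarrow>
    (\<forall>n. y n \<in> {..n} \<rightarrow>\<^sub>E UNIV) \<and> (\<forall>n i. i \<le> n \<longrightarrow> (y (Suc n) i :: 'a) ^ p = y n i)"
proof -
  have "witt_trunc_frob p n z = u \<longleftrightarrow> (\<forall>i\<le>n. z i ^ p = u i)"
    if "u \<in> {..n} \<rightarrow>\<^sub>E UNIV" for n and z u :: "nat \<Rightarrow> 'a"
    using PiE_arb[OF that] unfolding fun_eq_iff
    by (auto simp: witt_trunc_frob_def witt_trunc_def restrict_def witt_frob_eq_power[OF p char])
  then show ?thesis
    by (auto simp: invlim_witt_ring_def witt_trunc_ring_def)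
qed

lemma witt_to_invlim_surj:
  assumes y: "y \<in> carrier (invlim_witt_ring p)"
  shows "witt_to_invlim p (\<lambda>i. (y i i :: 'a) ^ (p ^ i)) = y"
proof (intro ext)
  fix n i
  have step: "y (Suc m) i ^ p = y m i" if "i \<le> m" for m
    using y that by (simp add: invlim_carrier_iff)
  have power: "y n i ^ (p ^ n) = y i i ^ (p ^ i)" if "i \<le> n"
    using that
  proof (induction n rule: dec_induct)
    case (step m)
    then show ?case using \<open>\<And>m. i \<le> m \<Longrightarrow> y (Suc m) i ^ p = y m i\<close>[of m] by (simp add: power_mult)
  qed simp
  show "witt_to_invlim p (\<lambda>i. y i i ^ (p ^ i)) n i = y n i"
  proof (cases "i \<le> n")
    case True
    then show ?thesis
      by (simp add: witt_to_invlim_def) (rule frob_root_unique, rule power)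
  next
    case False
    then have "y n i = undefined"
      using y by (auto simp: invlim_carrier_iff dest!: spec[of _ n] intro: PiE_arb)
    with False show ?thesis by (simp add: witt_to_invlim_def witt_trunc_def)
  qed
qed

lemma witt_to_invlim_iso:
  "witt_to_invlim p \<in> ring_iso (witt_ring p :: (nat \<Rightarrow> 'a) ring) (invlim_witt_ring p)"
proof -
  let ?f = "witt_to_invlim p :: (nat \<Rightarrow> 'a) \<Rightarrow> _"
  have carr: "?f x \<in> carrier (invlim_witt_ring p)" for x
  proof -
    have "frob_root (Suc n) x i ^ p = frob_root n x i" for n i
    proof -
      have "(frob_root (Suc n) x i ^ p) ^ (p ^ n) = frob_root n x i ^ (p ^ n)"
        using frob_root_power[of "Suc n" x i] frob_root_power[of n x i] by (simp add: power_mult)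
      then show ?thesis by (simp only: power_p_power_eq_iff)
    qed
    then show ?thesis
      unfolding invlim_carrier_iff by (simp add: witt_to_invlim_def) (simp add: witt_trunc_def)
  qed
  have "inj ?f"
  proof (rule injI, rule ext)
    fix x y :: "nat \<Rightarrow> 'a" and i
    assume "?f x = ?f y"
    then have "?f x i i = ?f y i i" by simp
    then have "frob_root i x i = frob_root i y i" by (simp add: witt_to_invlim_def)
    then show "x i = y i" by (metis frob_root_power)
  qed
  moreover have "range ?f = carrier (invlim_witt_ring p)"
    using carr witt_to_invlim_surj by (auto intro: rangeI[of ?f] simp: image_iff) metis
  ultimately have "bij_betw ?f UNIV (carrier (invlim_witt_ring p))"
    by (simp add: bij_betw_def)
  moreover have "?f \<in> ring_hom (witt_ring p) (invlim_witt_ring p)"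
  proof (rule ring_hom_memI)
    fix x y :: "nat \<Rightarrow> 'a"
    have "witt_trunc n (frob_root n (witt_mult p x y))
        = witt_trunc n (witt_mult p (witt_trunc n (frob_root n x)) (witt_trunc n (frob_root n y)))" for n
      unfolding frob_root_mult by (intro witt_trunc_cong witt_mult_local[OF p]) simp_all
    then show "?f (x \<otimes>\<^bsub>witt_ring p\<^esub> y) = ?f x \<otimes>\<^bsub>invlim_witt_ring p\<^esub> ?f y"
      by (simp add: fun_eq_iff witt_to_invlim_def witt_ring_def invlim_witt_ring_def witt_trunc_ring_def)
    have "witt_trunc n (frob_root n (witt_add p x y))
        = witt_trunc n (witt_add p (witt_trunc n (frob_root n x)) (witt_trunc n (frob_root n y)))" for n
      unfolding frob_root_add by (intro witt_trunc_cong witt_add_local[OF p]) simp_all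
    then show "?f (x \<oplus>\<^bsub>witt_ring p\<^esub> y) = ?f x \<oplus>\<^bsub>invlim_witt_ring p\<^esub> ?f y"
      by (simp add: fun_eq_iff witt_to_invlim_def witt_ring_def invlim_witt_ring_def witt_trunc_ring_def)
    show "?f \<one>\<^bsub>witt_ring p\<^esub> = \<one>\<^bsub>invlim_witt_ring p\<^esub>"
      by (simp add: fun_eq_iff witt_to_invlim_def witt_ring_def invlim_witt_ring_def
          witt_trunc_ring_def frob_root_one)
  qed (use carr in simp)
  ultimately show ?thesis by (simp add: ring_iso_def witt_ring_def)
qed

lemma witt_to_invlim_zero: "witt_to_invlim p \<zero>\<^bsub>witt_ring p\<^esub> = (\<zero>\<^bsub>invlim_witt_ring p\<^esub> :: nat \<Rightarrow> nat \<Rightarrow> 'a)"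
  by (simp add: fun_eq_iff witt_to_invlim_def witt_ring_def invlim_witt_ring_def
      witt_trunc_ring_def frob_root_zero)

lemma ring_invlim: "ring (invlim_witt_ring p :: (nat \<Rightarrow> nat \<Rightarrow> 'a) ring)"
proof -
  have "invlim_witt_ring p\<lparr>zero := \<zero>\<^bsub>invlim_witt_ring p\<^esub>\<rparr>
      = (invlim_witt_ring p :: (nat \<Rightarrow> nat \<Rightarrow> 'a) ring)" by simp
  with ring.ring_iso_imp_img_ring[OF ring_witt_ring[OF p] witt_to_invlim_iso]
  show ?thesis by (simp only: witt_to_invlim_zero)
qed

lemma subring_witt_to_invlim_image:
  assumes "subring S (witt_ring p :: (nat \<Rightarrow> 'a) ring)"
  shows "subring (witt_to_invlim p ` S) (invlim_witt_ring p)"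
proof -
  interpret ring_hom_ring "witt_ring p :: (nat \<Rightarrow> 'a) ring" "invlim_witt_ring p" "witt_to_invlim p"
    using witt_to_invlim_iso
    by (intro ring_hom_ringI2 ring_witt_ring[OF p] ring_invlim) (simp add: ring_iso_def)
  show ?thesis using assms by (rule img_is_subring)
qed

end

section \<open>Seminorm bounds for universal polynomials\<close>

definition monom_bounded :: "('v \<Rightarrow> real) \<Rightarrow> real \<Rightarrow> 'v int_mpoly \<Rightarrow> bool" where
  "monom_bounded N c P \<longleftrightarrow> (\<forall>m\<in>Poly_Mapping.keys P. monom_eval N m \<le> c)"

lemma monom_bounded_add: "monom_bounded N c P \<Longrightarrow> monom_bounded N c Q \<Longrightarrow> monom_bounded N c (P + Q)"
  using Poly_Mapping.keys_add[of P Q] by (auto simp: monom_bounded_def)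

lemma monom_bounded_uminus: "monom_bounded N c (- P) \<longleftrightarrow> monom_bounded N c P"
  by (simp add: monom_bounded_def in_keys_iff)

lemma monom_bounded_diff: "monom_bounded N c P \<Longrightarrow> monom_bounded N c Q \<Longrightarrow> monom_bounded N c (P - Q)"
  using monom_bounded_add[of N c P "- Q"] by (simp add: monom_bounded_uminus)

lemma monom_bounded_zero [simp]: "monom_bounded N c 0"
  by (simp add: monom_bounded_def)

lemma monom_bounded_sum:
  "(\<And>i. i \<in> S \<Longrightarrow> monom_bounded N c (f i)) \<Longrightarrow> monom_bounded N c (sum f S)"
  by (induction S rule: infinite_finite_induct) (auto intro: monom_bounded_add)

lemma monom_bounded_of_nat_times:
  assumes "k > 0"
  shows "monom_bounded N c (of_nat k * P) \<longleftrightarrow> monom_bounded N c P"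
proof -
  have "Poly_Mapping.keys (of_nat k * P) = Poly_Mapping.keys P"
    using assms by (auto simp: in_keys_iff lookup_of_nat_times)
  then show ?thesis by (simp add: monom_bounded_def)
qed

lemma monom_bounded_mult:
  assumes "\<And>v. 0 \<le> N v" "0 \<le> c" "monom_bounded N c P" "monom_bounded N d Q"
  shows "monom_bounded N (c * d) (P * Q)"
  unfolding monom_bounded_def
proof
  fix m assume "m \<in> Poly_Mapping.keys (P * Q)"
  with keys_mult[of P Q] obtain k l
    where "m = k + l" "k \<in> Poly_Mapping.keys P" "l \<in> Poly_Mapping.keys Q" by blast
  moreover have "0 \<le> monom_eval N l" using assms(1) by (simp add: monom_eval_def prod_nonneg)
  ultimately show "monom_eval N m \<le> c * d"
    using assms by (auto simp: monom_eval_add monom_bounded_def intro!: mult_mono)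
qed

lemma monom_bounded_power:
  assumes "\<And>v. 0 \<le> N v" "0 \<le> c" "monom_bounded N c P"
  shows "monom_bounded N (c ^ k) (P ^ k)"
proof (induction k)
  case 0
  then show ?case by (simp add: monom_bounded_def)
next
  case (Suc k)
  with assms show ?case by (simp add: monom_bounded_mult)
qed

lemma monom_bounded_ghost_term:
  assumes "p > 0" "\<And>v. 0 \<le> N v" "0 \<le> C" "i \<le> n" "monom_bounded N (C ^ (p ^ i)) P"
  shows "monom_bounded N (C ^ (p ^ n)) (of_nat p ^ i * P ^ (p ^ (n - i)))"
proof -
  have "(C ^ (p ^ i)) ^ (p ^ (n - i)) = C ^ (p ^ n)"
    using assms(4) by (simp flip: power_mult power_add)
  with monom_bounded_power[OF assms(2) _ assms(5), of "p ^ (n - i)"] assms(1,3)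
  show ?thesis
    by (simp add: monom_bounded_of_nat_times[of "p ^ i", simplified])
qed

lemma monom_bounded_ghost:
  assumes "p > 0" "\<And>v. 0 \<le> N v" "0 \<le> C" "\<And>i. i \<le> n \<Longrightarrow> monom_bounded N (C ^ (p ^ i)) (Z i)"
  shows "monom_bounded N (C ^ (p ^ n)) (ghost p n Z)"
  unfolding ghost_def using assms by (intro monom_bounded_sum monom_bounded_ghost_term) auto

text \<open>Scaling by a positive integer does not change the set of monomials, so that the bounds survive
  the division by \<open>p\<^sup>n\<close> in the recursion for the components.\<close>

lemma monom_bounded_component:
  assumes "p > 0" "\<And>v. 0 \<le> N v" "0 \<le> C"
    and "\<And>i. i \<le> n \<Longrightarrow> monom_bounded N (C ^ (p ^ i)) (ghost p i Z)"
  shows "monom_bounded N (C ^ (p ^ n)) (Z n)"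
  using assms(4)
proof (induction n rule: less_induct)
  case (less n)
  have "monom_bounded N (C ^ (p ^ n)) (ghost p n Z - (\<Sum>i<n. of_nat p ^ i * Z i ^ (p ^ (n - i))))"
    using assms(1-3) less
    by (intro monom_bounded_diff monom_bounded_sum monom_bounded_ghost_term) auto
  then show ?case
    using assms(1) by (simp add: ghost_split monom_bounded_of_nat_times[of "p ^ n", simplified])
qed

lemma tendsto_0_attains_max:
  fixes f :: "nat \<Rightarrow> real"
  assumes lim: "f \<longlonglongrightarrow> 0" and pos: "f m > 0"
  obtains n where "\<And>i. f i \<le> f n" "\<And>i. i < n \<Longrightarrow> f i < f n"
proof -
  obtain K where K: "\<And>i. i \<ge> K \<Longrightarrow> f i < f m"
    using order_tendstoD(2)[OF lim pos] by (auto simp: eventually_sequentially)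
  have "m < K" using K[of m] by (meson less_irrefl not_le)
  let ?M = "Max (f ` {..<K})"
  have le: "f i \<le> ?M" for i
  proof (cases "i < K")
    case False
    with K[of i] have "f i \<le> f m" by simp
    also have "f m \<le> ?M" using \<open>m < K\<close> by (intro Max_ge) auto
    finally show ?thesis .
  qed (auto intro: Max_ge)
  have "?M \<in> f ` {..<K}" using \<open>m < K\<close> by (intro Max_in) auto
  then have ex: "\<exists>n. f n = ?M" by auto
  define n where "n = (LEAST n. f n = ?M)"
  have n: "f n = ?M" unfolding n_def using ex by (rule LeastI_ex)
  have first: "f i < f n" if "i < n" for i
    using not_less_Least[OF that[unfolded n_def]] le[of i] n by simp
  have max: "f i \<le> f n" for i using le n by simp
  show ?thesis using that[OF max first] .
qed

locale perfect_seminormed =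
  fixes p :: nat and N :: "'a::comm_ring_1 \<Rightarrow> real"
  assumes p: "Factorial_Ring.prime p" and char: "CHAR('a) = p"
    and perfect: "bij (\<lambda>a::'a. a ^ p)"
    and N_nonneg: "\<And>a. 0 \<le> N a" and N_zero: "N 0 = 0"
    and N_add: "\<And>a b. N (a + b) \<le> max (N a) (N b)"
    and N_mult: "\<And>a b. N (a * b) \<le> N a * N b"
    and N_square: "\<And>a. (N a)\<^sup>2 \<le> N (a * a)"
begin

lemma p_pos: "p > 0"
  using p by (rule prime_gt_0_nat)

lemma N_one: "N 1 \<le> 1"
proof (rule ccontr)
  assume "\<not> N 1 \<le> 1"
  with mult_strict_left_mono[of 1 "N 1" "N 1"] N_square[of 1] show False
    by (simp add: power2_eq_square)
qed

lemma N_power_le: "N (a ^ k) \<le> N a ^ k"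
proof (induction k)
  case (Suc k)
  have "N (a ^ Suc k) \<le> N a * N (a ^ k)" by (simp add: N_mult)
  also have "\<dots> \<le> N a ^ Suc k" using Suc by (simp add: N_nonneg mult_left_mono)
  finally show ?case .
qed (simp add: N_one)

text \<open>Squaring repeatedly gives the exponents \<open>2 ^ m\<close>; for the others, compare \<open>a ^ k\<close> with
  \<open>a ^ (2 ^ k) = a ^ k a ^ (2 ^ k - k)\<close>.\<close>

lemma N_power:
  assumes "k > 0"
  shows "N (a ^ k) = N a ^ k"
proof (cases "N a = 0")
  case True
  with N_power_le[of a k] N_nonneg[of "a ^ k"] assms show ?thesis by (simp add: power_0_left)
next
  case False
  with N_nonneg[of a] have pos: "N a > 0" by simp
  have two: "N a ^ (2 ^ m) \<le> N (a ^ (2 ^ m))" for m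
  proof (induction m)
    case (Suc m)
    have "N a ^ (2 ^ Suc m) = (N a ^ (2 ^ m))\<^sup>2" by (simp add: mult.commute flip: power_mult)
    also have "\<dots> \<le> (N (a ^ (2 ^ m)))\<^sup>2" using Suc pos by (intro power_mono) auto
    also have "\<dots> \<le> N (a ^ (2 ^ m) * a ^ (2 ^ m))" by (rule N_square)
    also have "a ^ (2 ^ m) * a ^ (2 ^ m) = a ^ (2 ^ Suc m)" by (simp add: mult_2 flip: power_add)
    finally show ?case .
  qed simp
  have k: "2 ^ k = k + (2 ^ k - k)" by (simp add: less_imp_le)
  have "N a ^ k * N a ^ (2 ^ k - k) = N a ^ (2 ^ k)"
    using k by (metis power_add)
  also have "\<dots> \<le> N (a ^ (2 ^ k))" by (rule two)
  also have "a ^ (2 ^ k) = a ^ k * a ^ (2 ^ k - k)" using k by (metis power_add)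
  also have "N \<dots> \<le> N (a ^ k) * N (a ^ (2 ^ k - k))" by (rule N_mult)
  also have "\<dots> \<le> N (a ^ k) * N a ^ (2 ^ k - k)" by (intro mult_left_mono N_power_le N_nonneg)
  finally have "N a ^ k \<le> N (a ^ k)" using pos by simp
  with N_power_le[of a k] show ?thesis by simp
qed

lemma N_of_int: "N (of_int c) \<le> 1"
proof -
  have nat: "N (of_nat k) \<le> 1" for k
  proof (induction k)
    case (Suc k)
    with N_add[of 1 "of_nat k"] N_one show ?case by simp
  qed (simp add: N_zero)
  have "of_int c = (of_int (c mod int p) :: 'a)"
  proof -
    have "(of_int c :: 'a) = of_int (int p * (c div int p) + c mod int p)" by simp
    also have "\<dots> = of_int (c mod int p)"
      using of_nat_CHAR[where 'a = 'a] char by (simp only: of_int_add of_int_mult of_int_of_nat_eq) simp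
    finally show ?thesis .
  qed
  also have "\<dots> = of_nat (nat (c mod int p))" using p_pos by simp
  finally show ?thesis by (simp add: nat)
qed

lemma N_prod: "N (\<Prod>i\<in>S. f i) \<le> (\<Prod>i\<in>S. N (f i))"
proof (induction S rule: infinite_finite_induct)
  case (insert i S)
  have "N (\<Prod>i\<in>insert i S. f i) \<le> N (f i) * N (\<Prod>i\<in>S. f i)" using insert by (simp add: N_mult)
  also have "\<dots> \<le> N (f i) * (\<Prod>i\<in>S. N (f i))" using insert by (intro mult_left_mono N_nonneg)
  finally show ?case using insert by simp
qed (simp_all add: N_one)

lemma N_sum:
  assumes "0 \<le> c" "\<And>i. i \<in> S \<Longrightarrow> N (f i) \<le> c"
  shows "N (sum f S) \<le> c"
  using assms(2)
proof (induction S rule: infinite_finite_induct)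
  case (insert i S)
  have "N (f i + sum f S) \<le> max (N (f i)) (N (sum f S))" by (rule N_add)
  also have "\<dots> \<le> c" using insert by simp
  finally show ?case using insert.hyps by simp
qed (simp_all add: N_zero assms(1))

lemma N_eval:
  assumes "monom_bounded N c P" "0 \<le> c"
  shows "N (eval id P) \<le> c"
proof -
  have monomial: "N (of_int (Poly_Mapping.lookup P m) * monom_eval id m) \<le> c"
    if "m \<in> Poly_Mapping.keys P" for m
  proof -
    have monomial: "N (of_int (Poly_Mapping.lookup P m) * monom_eval id m) \<le> 1 * N (monom_eval id m)"
      using N_mult by (rule order_trans) (intro mult_right_mono N_of_int N_nonneg)
    also have "\<dots> \<le> (\<Prod>v\<in>Poly_Mapping.keys m. N (v ^ Poly_Mapping.lookup m v))"
      using N_prod by (simp add: monom_eval_def)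
    also have "\<dots> \<le> monom_eval N m"
      unfolding monom_eval_def by (intro prod_mono) (simp add: N_nonneg N_power_le)
    also have "\<dots> \<le> c" using assms(1) that by (simp add: monom_bounded_def)
    finally show ?thesis .
  qed
  have "eval id P = (\<Sum>m\<in>Poly_Mapping.keys P. of_int (Poly_Mapping.lookup P m) * monom_eval id m)"
    by (rule eval_superset) simp_all
  also have "N \<dots> \<le> c" using assms(2) monomial by (rule N_sum)
  finally show ?thesis .
qed

lemma monom_bounded_lift: "N a \<le> c \<Longrightarrow> monom_bounded N c (lift a)"
  by (simp add: lift_def var_def monom_bounded_def)

lemma monom_bounded_ghost_lift:
  assumes "0 \<le> C" "\<And>i. i \<le> n \<Longrightarrow> N (x i) \<le> C ^ (p ^ i)"
  shows "monom_bounded N (C ^ (p ^ n)) (ghost p n (lift_vec x))"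
  by (rule monom_bounded_ghost[OF p_pos N_nonneg assms(1)]) (rule monom_bounded_lift, rule assms(2))

text \<open>The constant \<open>C\<close> bounds the numbers \<open>|x\<^sub>i| ^ (1 / p\<^sup>i)\<close> and \<open>|y\<^sub>i| ^ (1 / p\<^sup>i)\<close> for \<open>i \<le> n\<close>. Such
  bounds hold for all monomials of the lifts to the polynomial ring and thus of their ghost
  components, from which they are carried over to the lift of the sum.\<close>

lemma N_witt_add:
  assumes "0 \<le> C" "\<And>i. i \<le> n \<Longrightarrow> N (x i) \<le> C ^ (p ^ i)" "\<And>i. i \<le> n \<Longrightarrow> N (y i) \<le> C ^ (p ^ i)"
  shows "N (witt_add p x y n) \<le> C ^ (p ^ n)"
proof -
  have "monom_bounded N (C ^ (p ^ n)) (witt_add p (lift_vec x) (lift_vec y) n)"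
  proof (rule monom_bounded_component[OF p_pos N_nonneg assms(1)])
    fix i assume "i \<le> n"
    with assms show "monom_bounded N (C ^ (p ^ i)) (ghost p i (witt_add p (lift_vec x) (lift_vec y)))"
      by (simp add: ghost_witt[OF p] monom_bounded_add monom_bounded_ghost_lift)
  qed
  from N_eval[OF this] assms(1) show ?thesis by (simp add: eval_witt)
qed

lemma N_witt_neg:
  assumes "0 \<le> C" "\<And>i. i \<le> n \<Longrightarrow> N (x i) \<le> C ^ (p ^ i)"
  shows "N (witt_neg p x n) \<le> C ^ (p ^ n)"
proof -
  have "monom_bounded N (C ^ (p ^ n)) (witt_neg p (lift_vec x) n)"
  proof (rule monom_bounded_component[OF p_pos N_nonneg assms(1)])
    fix i assume "i \<le> n"
    with assms show "monom_bounded N (C ^ (p ^ i)) (ghost p i (witt_neg p (lift_vec x)))"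
      by (simp add: ghost_witt[OF p] monom_bounded_uminus monom_bounded_ghost_lift)
  qed
  from N_eval[OF this] assms(1) show ?thesis by (simp add: eval_witt)
qed


section \<open>Bounded Witt vectors\<close>

definition witt_bounded :: "(nat \<Rightarrow> real) \<Rightarrow> (nat \<Rightarrow> 'a) \<Rightarrow> bool" where
  "witt_bounded c x \<longleftrightarrow> (\<forall>i. N (x i) \<le> c i ^ (p ^ i))"

lemma witt_bounded_mono: "witt_bounded c x \<Longrightarrow> (\<And>i. 0 \<le> c i) \<Longrightarrow> (\<And>i. c i \<le> d i) \<Longrightarrow> witt_bounded d x"
  unfolding witt_bounded_def by (meson order_trans power_mono)

lemma witt_bounded_le:
  assumes "mono c" "\<And>i. 0 \<le> c i" "witt_bounded c x" "i \<le> n"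
  shows "N (x i) \<le> c n ^ (p ^ i)"
  using assms unfolding witt_bounded_def by (meson monoD order_trans power_mono)

lemma witt_bounded_add:
  assumes "mono c" "\<And>i. 0 \<le> c i" "witt_bounded c x" "witt_bounded c y"
  shows "witt_bounded c (witt_add p x y)"
  unfolding witt_bounded_def
  using N_witt_add[OF assms(2) witt_bounded_le[OF assms(1,2,3)] witt_bounded_le[OF assms(1,2,4)]]
  by simp

lemma witt_bounded_neg:
  assumes "mono c" "\<And>i. 0 \<le> c i" "witt_bounded c x"
  shows "witt_bounded c (witt_neg p x)"
  unfolding witt_bounded_def
  using N_witt_neg[OF assms(2) witt_bounded_le[OF assms]] by simp

text \<open>The argument for sums would only give the product of the maxima of \<open>c\<close> and of \<open>d\<close> up to \<open>n\<close> as
  a bound in degree \<open>n\<close>. But in characteristic \<open>p\<close> the term \<open>V\<^sup>i[x\<^sub>i] V\<^sup>j[y\<^sub>j]\<close> of the product lives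
  in degree \<open>i + j\<close> alone, and \<open>e\<close> is nondecreasing, so that adding these terms up keeps the bound.\<close>

lemma witt_bounded_mult:
  assumes mono: "mono e" and nonneg: "\<And>i. 0 \<le> c i" "\<And>j. 0 \<le> d j"
    and le: "\<And>i j. c i * d j \<le> e (i + j)"
    and x: "witt_bounded c x" and y: "witt_bounded d y"
  shows "witt_bounded e (witt_mult p x y)"
proof -
  (* In each degree the product only depends on finitely many components of x and y. *)
  define cut :: "nat \<Rightarrow> (nat \<Rightarrow> 'a) \<Rightarrow> nat \<Rightarrow> 'a" where "cut k u = (\<lambda>i. if i < k then u i else 0)" for k u
  have cut_0: "cut 0 u = witt_zero" for u
    by (simp add: cut_def fun_eq_iff witt_zero_def)
  have cut_Suc: "cut (Suc k) u = witt_add p (cut k u) (witt_single k (u k))" for k u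
    by (subst witt_add_disjoint[OF p]) (auto simp: cut_def witt_single_def fun_eq_iff)
  have e_nonneg: "0 \<le> e k" for k
    using le[of 0 k] nonneg(1)[of 0] nonneg(2)[of k] by (metis add_0 mult_nonneg_nonneg order_trans)
  have zero: "witt_bounded e witt_zero"
    by (simp add: witt_bounded_def witt_zero_def N_zero e_nonneg)
  note add = witt_bounded_add[OF mono e_nonneg]
  have single: "witt_bounded e (witt_mult p (witt_single i (x i)) (witt_single j (y j)))" for i j
  proof -
    have "N (x i ^ (p ^ j) * y j ^ (p ^ i)) \<le> N (x i) ^ (p ^ j) * N (y j) ^ (p ^ i)"
      using N_mult by (rule order_trans) (intro mult_mono N_power_le N_nonneg zero_le_power)
    also have "\<dots> \<le> (c i ^ (p ^ i)) ^ (p ^ j) * (d j ^ (p ^ j)) ^ (p ^ i)"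
      using x y nonneg by (intro mult_mono power_mono N_nonneg zero_le_power) (auto simp: witt_bounded_def)
    also have "\<dots> = (c i * d j) ^ (p ^ (i + j))"
      by (simp add: power_mult_distrib power_add mult.commute flip: power_mult)
    also have "\<dots> \<le> e (i + j) ^ (p ^ (i + j))"
      by (intro power_mono le mult_nonneg_nonneg nonneg)
    finally show ?thesis
      by (simp add: witt_mult_single[OF p char] witt_bounded_def witt_single_def N_zero e_nonneg)
  qed
  have single_cut: "witt_bounded e (witt_mult p (witt_single i (x i)) (cut l y))" for i l
    by (induction l) (simp_all add: cut_0 cut_Suc witt_distrib_left[OF p] witt_mult_zero[OF p]
        witt_mult_commute[OF p, of _ witt_zero] zero add single)
  have "witt_bounded e (witt_mult p (cut k x) (cut l y))" for k l
    by (induction k) (simp_all add: cut_0 cut_Suc witt_distrib[OF p] witt_mult_zero[OF p]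
        zero add single_cut)
  moreover have "witt_mult p x y n = witt_mult p (cut (Suc n) x) (cut (Suc n) y) n" for n
    by (intro witt_mult_local[OF p]) (simp_all add: cut_def)
  ultimately show ?thesis by (simp add: witt_bounded_def)
qed


section \<open>Growth conditions\<close>

definition weight :: "real \<Rightarrow> nat \<Rightarrow> real" where
  "weight b i = real p powr (b * real i)"

definition radius :: "(nat \<Rightarrow> 'a) \<Rightarrow> nat \<Rightarrow> real" where
  "radius x i = N (x i) powr (1 / real p ^ i)"

lemma p_gt_1: "real p > 1"
  using prime_gt_1_nat[OF p] by simp

lemma weight_pos [simp]: "weight b i > 0"
  using p_pos by (simp add: weight_def)

lemma weight_nonneg [simp]: "weight b i \<ge> 0"
  by (simp add: less_imp_le)

lemma weight_add: "weight b (i + j) = weight b i * weight b j"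
  by (simp add: weight_def powr_add ring_distribs)

lemma weight_mono: "b > 0 \<Longrightarrow> i \<le> j \<Longrightarrow> weight b i \<le> weight b j"
  using p_gt_1 by (simp add: weight_def)

lemma weight_mono_exponent: "b \<le> b' \<Longrightarrow> weight b i \<le> weight b' i"
  using p_gt_1 by (simp add: weight_def mult_right_mono)

lemma inverse_weight_tendsto: "b > 0 \<Longrightarrow> (\<lambda>n. D / weight b n) \<longlonglongrightarrow> 0"
proof -
  assume "b > 0"
  have w: "weight b n = (real p powr b) ^ n" for n
    using p_pos by (simp add: weight_def powr_power mult.commute)
  have "real p powr b > 1" using \<open>b > 0\<close> p_gt_1 by simp
  then show ?thesis unfolding w by (rule LIMSEQ_divide_realpow_zero)
qed

lemma radius_nonneg [simp]: "radius x i \<ge> 0"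
  by (simp add: radius_def)

lemma root_le_iff: "0 \<le> a \<Longrightarrow> 0 \<le> c \<Longrightarrow> a powr (1 / real p ^ i) \<le> c \<longleftrightarrow> a \<le> c ^ (p ^ i)"
proof -
  assume a: "0 \<le> a" and c: "0 \<le> c"
  have "(a powr (1 / real p ^ i)) ^ (p ^ i) = a"
  proof (cases "a = 0")
    case False
    with a p_pos show ?thesis by (simp add: powr_powr flip: powr_realpow)
  qed (use p_pos in \<open>simp add: power_0_left\<close>)
  then show ?thesis
    using power_mono_iff[of "a powr (1 / real p ^ i)" c "p ^ i"] c p_pos by simp
qed

lemma radius_le_iff: "0 \<le> c \<Longrightarrow> radius x i \<le> c \<longleftrightarrow> N (x i) \<le> c ^ (p ^ i)"
  by (simp add: radius_def root_le_iff N_nonneg)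

lemma witt_bounded_iff_radius: "(\<And>i. 0 \<le> c i) \<Longrightarrow> witt_bounded c x \<longleftrightarrow> (\<forall>i. radius x i \<le> c i)"
  by (simp add: witt_bounded_def radius_le_iff)

lemma radius_power: "radius x i ^ (p ^ i) = N (x i)"
  using radius_le_iff[of "radius x i" x i] radius_le_iff[of "root (p ^ i) (N (x i))" x i]
    p_pos N_nonneg[of "x i"]
  by (intro antisym) (auto simp: real_root_pow_pos2 dest: power_mono[of "radius x i" _ "p ^ i"])

lemma mem_witt_b_iff: "x \<in> witt_b p N b \<longleftrightarrow> (\<lambda>n. radius x n / weight b n) \<longlonglongrightarrow> 0"
  by (simp add: witt_b_def witt_ring_def radius_def weight_def powr_minus divide_inverse mult.commute)

text \<open>A nondecreasing bound, hence preserved by addition; with \<open>D\<close> depending on \<open>e\<close>, these bounds for all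
  \<open>e > 0\<close> together amount to membership in \<open>W\<^sup>b(R)\<close>.\<close>

definition growth_bound :: "real \<Rightarrow> real \<Rightarrow> real \<Rightarrow> nat \<Rightarrow> real" where
  "growth_bound b e D i = max D (e * weight b i)"

lemma growth_bound_mono:
  assumes "b > 0" "e \<ge> 0"
  shows "mono (growth_bound b e D)"
  unfolding growth_bound_def using assms
  by (intro monoI max.mono order_refl mult_left_mono weight_mono)

lemma growth_bound_nonneg: "e \<ge> 0 \<Longrightarrow> growth_bound b e D i \<ge> 0"
  by (simp add: growth_bound_def le_max_iff_disj)

lemma mem_witt_b_iff_bounded:
  assumes b: "b > 0"
  shows "x \<in> witt_b p N b \<longleftrightarrow> (\<forall>e>0. \<exists>D\<ge>0. witt_bounded (growth_bound b e D) x)"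
proof
  assume "x \<in> witt_b p N b"
  then have lim: "(\<lambda>n. radius x n / weight b n) \<longlonglongrightarrow> 0" by (simp add: mem_witt_b_iff)
  show "\<forall>e>0. \<exists>D\<ge>0. witt_bounded (growth_bound b e D) x"
  proof (intro allI impI)
    fix e :: real assume e: "e > 0"
    from order_tendstoD(2)[OF lim e] obtain K where K: "\<And>n. n \<ge> K \<Longrightarrow> radius x n / weight b n < e"
      by (auto simp: eventually_sequentially)
    let ?D = "\<Sum>i<K. radius x i"
    have "radius x i \<le> growth_bound b e ?D i" for i
    proof (cases "i < K")
      case True
      then have "radius x i \<le> ?D" by (intro member_le_sum) auto
      then show ?thesis by (simp add: growth_bound_def)
    next
      case False
      with K[of i] have "radius x i < e * weight b i" by (simp add: divide_less_eq)
      then show ?thesis by (simp add: growth_bound_def)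
    qed
    then have "witt_bounded (growth_bound b e ?D) x"
      using e by (simp add: witt_bounded_iff_radius growth_bound_nonneg)
    moreover have "?D \<ge> 0" by (intro sum_nonneg) simp
    ultimately show "\<exists>D\<ge>0. witt_bounded (growth_bound b e D) x" by blast
  qed
next
  assume bounded: "\<forall>e>0. \<exists>D\<ge>0. witt_bounded (growth_bound b e D) x"
  have "(\<lambda>n. radius x n / weight b n) \<longlonglongrightarrow> 0"
  proof (rule order_tendstoI)
    fix r :: real assume r: "r > 0"
    from bounded r obtain D where D: "witt_bounded (growth_bound b (r / 2) D) x"
      by (meson half_gt_zero)
    have "\<forall>\<^sub>F n in sequentially. D / weight b n < r"
      using order_tendstoD(2)[OF inverse_weight_tendsto[OF b] r] .
    then show "\<forall>\<^sub>F n in sequentially. radius x n / weight b n < r"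
    proof eventually_elim
      case (elim n)
      have "radius x n \<le> growth_bound b (r / 2) D n"
        using D r by (simp add: witt_bounded_iff_radius growth_bound_nonneg)
      also have "\<dots> < r * weight b n"
        using elim r by (simp add: growth_bound_def divide_less_eq)
      finally show ?case by (simp add: divide_less_eq)
    qed
  next
    fix r :: real assume "r < 0"
    then show "\<forall>\<^sub>F n in sequentially. r < radius x n / weight b n"
      by (intro always_eventually allI) (metis divide_nonneg_nonneg less_le_trans radius_nonneg weight_nonneg)
  qed
  then show "x \<in> witt_b p N b" by (simp add: mem_witt_b_iff)
qed

lemma witt_b_bounded:
  assumes "x \<in> witt_b p N b"
  obtains A where "A > 0" "witt_bounded (\<lambda>i. A * weight b i) x"
proof -
  have "Bseq (\<lambda>n. radius x n / weight b n)"
    using assms by (intro convergent_imp_Bseq) (auto simp: mem_witt_b_iff convergent_def)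
  then obtain A where A: "A > 0" "\<And>n. norm (radius x n / weight b n) \<le> A"
    by (auto simp: Bseq_def)
  then have "radius x n \<le> A * weight b n" for n
    using A(2)[of n] by (simp add: divide_le_eq)
  with A(1) show ?thesis by (intro that[of A]) (auto simp: witt_bounded_iff_radius)
qed

lemma mono_weight: "b > 0 \<Longrightarrow> K \<ge> 0 \<Longrightarrow> mono (\<lambda>i. K * weight b i)"
  by (intro monoI mult_left_mono weight_mono)

lemma witt_b_add:
  assumes b: "b > 0" and x: "x \<in> witt_b p N b" and y: "y \<in> witt_b p N b"
  shows "witt_add p x y \<in> witt_b p N b"
  unfolding mem_witt_b_iff_bounded[OF b]
proof (intro allI impI)
  fix e :: real assume e: "e > 0"
  with x y obtain D D' where D: "D \<ge> 0" "witt_bounded (growth_bound b e D) x"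
    and D': "witt_bounded (growth_bound b e D') y"
    by (meson mem_witt_b_iff_bounded[OF b])
  let ?c = "growth_bound b e (max D D')"
  have "witt_bounded ?c x" "witt_bounded ?c y"
    using D(2) D' e by (auto intro: witt_bounded_mono[OF _ growth_bound_nonneg] simp: growth_bound_def)
  with e b have "witt_bounded ?c (witt_add p x y)"
    by (intro witt_bounded_add growth_bound_mono growth_bound_nonneg) auto
  with D(1) show "\<exists>D\<ge>0. witt_bounded (growth_bound b e D) (witt_add p x y)"
    by (intro exI[of _ "max D D'"]) auto
qed

lemma witt_b_neg:
  assumes b: "b > 0" and x: "x \<in> witt_b p N b"
  shows "witt_neg p x \<in> witt_b p N b"
  unfolding mem_witt_b_iff_bounded[OF b]
proof (intro allI impI)
  fix e :: real assume e: "e > 0"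
  with x obtain D where D: "D \<ge> 0" "witt_bounded (growth_bound b e D) x"
    by (meson mem_witt_b_iff_bounded[OF b])
  with e b have "witt_bounded (growth_bound b e D) (witt_neg p x)"
    by (intro witt_bounded_neg growth_bound_mono growth_bound_nonneg) auto
  with D(1) show "\<exists>D\<ge>0. witt_bounded (growth_bound b e D) (witt_neg p x)" by blast
qed

text \<open>If one of the two radii is a small multiple of the weight, the other one is at most its norm times
  the weight; otherwise both are at most the respective constants.\<close>

lemma witt_b_mult:
  assumes b: "b > 0" and x: "x \<in> witt_b p N b" and y: "y \<in> witt_b p N b"
  shows "witt_mult p x y \<in> witt_b p N b"
  unfolding mem_witt_b_iff_bounded[OF b]
proof (intro allI impI)
  fix e :: real assume e: "e > 0"
  obtain A where A: "A > 0" "witt_bounded (\<lambda>i. A * weight b i) x" by (rule witt_b_bounded[OF x])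
  obtain B where B: "B > 0" "witt_bounded (\<lambda>i. B * weight b i) y" by (rule witt_b_bounded[OF y])
  obtain D where D: "D \<ge> 0" "witt_bounded (growth_bound b (e / B) D) x"
    using x e B(1) by (meson mem_witt_b_iff_bounded[OF b] divide_pos_pos)
  obtain D' where D': "D' \<ge> 0" "witt_bounded (growth_bound b (e / A) D') y"
    using y e A(1) by (meson mem_witt_b_iff_bounded[OF b] divide_pos_pos)
  have rx: "radius x i \<le> A * weight b i" "radius x i \<le> D \<or> radius x i \<le> e / B * weight b i" for i
    using A D e B(1) by (auto simp: witt_bounded_iff_radius growth_bound_nonneg growth_bound_def
        le_max_iff_disj)
  have ry: "radius y i \<le> B * weight b i" "radius y i \<le> D' \<or> radius y i \<le> e / A * weight b i" for i
    using B D' e A(1) by (auto simp: witt_bounded_iff_radius growth_bound_nonneg growth_bound_def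
        le_max_iff_disj)
  have "radius x i * radius y j \<le> growth_bound b e (D * D') (i + j)" for i j
  proof -
    consider "radius x i \<le> D" "radius y j \<le> D'" | "radius x i \<le> e / B * weight b i"
      | "radius y j \<le> e / A * weight b j" using rx(2)[of i] ry(2)[of j] by blast
    then show ?thesis
    proof cases
      case 1
      then have "radius x i * radius y j \<le> D * D'" using D(1) by (intro mult_mono) auto
      then show ?thesis by (simp add: growth_bound_def)
    next
      case 2
      with ry(1)[of j] e B(1)
      have "radius x i * radius y j \<le> (e / B * weight b i) * (B * weight b j)"
        by (intro mult_mono) auto
      then show ?thesis using B(1) by (simp add: growth_bound_def weight_add mult_ac)
    next
      case 3
      with rx(1)[of i] e A(1)
      have "radius x i * radius y j \<le> (A * weight b i) * (e / A * weight b j)"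
        by (intro mult_mono) auto
      then show ?thesis using A(1) by (simp add: growth_bound_def weight_add mult_ac)
    qed
  qed
  then have "witt_bounded (growth_bound b e (D * D')) (witt_mult p x y)"
    using e b by (intro witt_bounded_mult[where c = "radius x" and d = "radius y"] growth_bound_mono)
      (auto simp: witt_bounded_iff_radius)
  with D(1) D'(1) show "\<exists>D\<ge>0. witt_bounded (growth_bound b e D) (witt_mult p x y)"
    by (intro exI[of _ "D * D'"]) simp
qed

lemma witt_b_one:
  assumes b: "b > 0"
  shows "witt_one \<in> witt_b p N b"
  unfolding mem_witt_b_iff_bounded[OF b]
proof (intro allI impI)
  fix e :: real
  have "N (witt_one i) \<le> 1 ^ (p ^ i)" for i
    by (simp add: witt_one_def N_one N_zero)
  then have "witt_bounded (\<lambda>_. 1) witt_one" by (simp add: witt_bounded_def)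
  then have "witt_bounded (growth_bound b e 1) witt_one"
    by (rule witt_bounded_mono) (simp_all add: growth_bound_def)
  then show "\<exists>D\<ge>0. witt_bounded (growth_bound b e D) witt_one" by (intro exI[of _ 1]) simp
qed

lemma subring_witt_b:
  assumes "b > 0"
  shows "subring (witt_b p N b) (witt_ring p)"
proof (rule ring.subringI[OF ring_witt_ring[OF p]])
  fix x y assume "x \<in> witt_b p N b" "y \<in> witt_b p N b"
  with assms show "x \<otimes>\<^bsub>witt_ring p\<^esub> y \<in> witt_b p N b" "x \<oplus>\<^bsub>witt_ring p\<^esub> y \<in> witt_b p N b"
    by (simp_all add: witt_ring_def witt_b_mult witt_b_add)
next
  fix x assume "x \<in> witt_b p N b"
  with assms show "\<ominus>\<^bsub>witt_ring p\<^esub> x \<in> witt_b p N b"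
    by (simp add: witt_ring_a_inv[OF p] witt_b_neg)
qed (use witt_b_one[OF assms] in \<open>auto simp: witt_ring_def\<close>)

lemma witt_b_mono:
  assumes "0 < b" "b \<le> b'"
  shows "witt_b p N b \<subseteq> witt_b p N b'"
proof
  fix x assume x: "x \<in> witt_b p N b"
  have "growth_bound b e D i \<le> growth_bound b' e D i" if "e > 0" for e D i
    unfolding growth_bound_def using that assms(2)
    by (intro max.mono order_refl mult_left_mono weight_mono_exponent) auto
  with x assms show "x \<in> witt_b p N b'"
    by (simp add: mem_witt_b_iff_bounded)
       (meson growth_bound_nonneg less_imp_le witt_bounded_mono)
qed

lemma overconvergent_witt_eq: "overconvergent_witt p N = (\<Union>b\<in>{0<..}. witt_b p N b)"
  by (auto simp: overconvergent_witt_def witt_b_def)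

lemma subring_overconvergent_witt: "subring (overconvergent_witt p N) (witt_ring p)"
proof (rule ring.subringI[OF ring_witt_ring[OF p]])
  fix x y assume "x \<in> overconvergent_witt p N" "y \<in> overconvergent_witt p N"
  then obtain b b' where b: "b > 0" "b' > 0" and "x \<in> witt_b p N b" "y \<in> witt_b p N b'"
    by (auto simp: overconvergent_witt_eq)
  with witt_b_mono[of b "max b b'"] witt_b_mono[of b' "max b b'"]
  have "x \<in> witt_b p N (max b b')" "y \<in> witt_b p N (max b b')" by auto
  with subringE(6,7)[OF subring_witt_b[of "max b b'"]] b
  show "x \<otimes>\<^bsub>witt_ring p\<^esub> y \<in> overconvergent_witt p N" "x \<oplus>\<^bsub>witt_ring p\<^esub> y \<in> overconvergent_witt p N"
    by (auto simp: overconvergent_witt_eq intro!: bexI[of _ "max b b'"])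
next
  fix x assume "x \<in> overconvergent_witt p N"
  then show "\<ominus>\<^bsub>witt_ring p\<^esub> x \<in> overconvergent_witt p N"
    using subringE(5)[OF subring_witt_b] by (fastforce simp: overconvergent_witt_eq)
next
  show "\<one>\<^bsub>witt_ring p\<^esub> \<in> overconvergent_witt p N"
    using subringE(3)[OF subring_witt_b[of 1]] by (auto simp: overconvergent_witt_eq intro!: bexI[of _ 1])
qed (simp add: witt_ring_def)


section \<open>The seminorm on the inverse limit\<close>

text \<open>The \<open>i\<close>-th component \<open>z\<close> of the \<open>n\<close>-th entry satisfies \<open>z ^ (p\<^sup>n) = x\<^sub>i\<close>, whence \<open>|z| ^ (p\<^sup>n) = |x\<^sub>i|\<close> by
  power-multiplicativity; this cancels the \<open>p\<^sup>n\<close>-th power in the term.\<close>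

lemma invlim_term_le_iff:
  assumes K: "K \<ge> 0"
  shows "invlim_term p N b (witt_to_invlim p x) n \<le> K \<longleftrightarrow> (\<forall>i\<le>n. radius x i \<le> K * weight b n)"
proof -
  let ?L = "K * weight b n" and ?f = "\<lambda>i. N (witt_to_invlim p x n i) powr (1 / real p ^ i)"
  let ?s = "SUP i\<in>{..n}. ?f i"
  have L: "?L \<ge> 0" using K by simp
  have bdd: "bdd_above (?f ` {..n})" by simp
  have s: "?s \<ge> 0"
    using cSUP_upper2[OF bdd, of 0 0] by simp
  have "invlim_term p N b (witt_to_invlim p x) n = ?s ^ (p ^ n) / weight b n"
    by (simp add: invlim_term_def witt_trunc_norm_def weight_def powr_minus divide_inverse mult.commute)
  then have "invlim_term p N b (witt_to_invlim p x) n \<le> K \<longleftrightarrow> ?s ^ (p ^ n) \<le> ?L"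
    by (simp add: pos_divide_le_eq)
  also have "\<dots> \<longleftrightarrow> ?s \<le> root (p ^ n) ?L"
    using L p_pos s real_root_pow_pos2[of "p ^ n" ?L] power_mono_iff[of ?s "root (p ^ n) ?L" "p ^ n"] by simp
  also have "\<dots> \<longleftrightarrow> (\<forall>i\<le>n. ?f i \<le> root (p ^ n) ?L)"
    by (subst cSUP_le_iff[OF _ bdd]) auto
  also have "\<dots> \<longleftrightarrow> (\<forall>i\<le>n. radius x i \<le> ?L)"
  proof -
    have "?f i \<le> root (p ^ n) ?L \<longleftrightarrow> radius x i \<le> ?L" if i: "i \<le> n" for i
    proof -
      let ?z = "witt_to_invlim p x n i"
      have z: "?z ^ (p ^ n) = x i"
        using i by (simp add: witt_to_invlim_def witt_trunc_def frob_root_power[OF p char perfect])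
      have "?f i \<le> root (p ^ n) ?L \<longleftrightarrow> N ?z \<le> root (p ^ n) ?L ^ (p ^ i)"
        using L p_pos by (intro root_le_iff N_nonneg) simp
      also have "\<dots> \<longleftrightarrow> N ?z ^ (p ^ n) \<le> (root (p ^ n) ?L ^ (p ^ i)) ^ (p ^ n)"
        using L p_pos N_nonneg by (intro power_mono_iff[symmetric]) simp_all
      also have "N ?z ^ (p ^ n) = N (x i)"
        using N_power[of "p ^ n" ?z] p_pos z by simp
      also have "(root (p ^ n) ?L ^ (p ^ i)) ^ (p ^ n) = (root (p ^ n) ?L ^ (p ^ n)) ^ (p ^ i)"
        by (metis mult.commute power_mult)
      also have "root (p ^ n) ?L ^ (p ^ n) = ?L"
        using L p_pos by (simp add: real_root_pow_pos2)
      finally show ?thesis using L by (simp only: radius_le_iff)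
    qed
    then show ?thesis by simp
  qed
  finally show ?thesis .
qed

lemma invlim_term_nonneg: "invlim_term p N b y n \<ge> 0"
proof -
  have "witt_trunc_norm p N n (y n) \<ge> 0"
    unfolding witt_trunc_norm_def by (rule cSUP_upper2[where x = 0]) simp_all
  then show ?thesis by (simp add: invlim_term_def)
qed

lemma witt_to_invlim_mem_iff:
  assumes b: "b > 0"
  shows "witt_to_invlim p x \<in> invlim_b p N b \<longleftrightarrow> x \<in> witt_b p N b"
proof -
  let ?t = "invlim_term p N b (witt_to_invlim p x)"
  have "?t \<longlonglongrightarrow> 0 \<longleftrightarrow> x \<in> witt_b p N b"
  proof
    assume lim: "?t \<longlonglongrightarrow> 0"
    have le: "radius x n / weight b n \<le> ?t n" for n
      using invlim_term_le_iff[of "?t n" b x n] invlim_term_nonneg by (simp add: divide_le_eq)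
    have "(\<lambda>n. radius x n / weight b n) \<longlonglongrightarrow> 0"
      by (rule tendsto_sandwich[OF _ _ tendsto_const lim]) (simp_all add: le)
    then show "x \<in> witt_b p N b" by (simp add: mem_witt_b_iff)
  next
    assume x: "x \<in> witt_b p N b"
    show "?t \<longlonglongrightarrow> 0"
    proof (rule order_tendstoI)
      fix r :: real assume r: "r > 0"
      from x r obtain D where D: "D \<ge> 0" "witt_bounded (growth_bound b (r / 2) D) x"
        by (meson mem_witt_b_iff_bounded[OF b] half_gt_zero)
      have "\<forall>\<^sub>F n in sequentially. D / weight b n < r"
        using order_tendstoD(2)[OF inverse_weight_tendsto[OF b] r] .
      then show "\<forall>\<^sub>F n in sequentially. ?t n < r"
      proof eventually_elim
        case (elim n)
        have "radius x i \<le> max (D / weight b n) (r / 2) * weight b n" if "i \<le> n" for i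
        proof -
          have "radius x i \<le> growth_bound b (r / 2) D i"
            using D r by (simp add: witt_bounded_iff_radius growth_bound_nonneg)
          also have "\<dots> \<le> growth_bound b (r / 2) D n"
            using growth_bound_mono[of b "r / 2" D] b r that by (auto dest: monoD)
          also have "\<dots> = max (D / weight b n) (r / 2) * weight b n"
            by (simp add: growth_bound_def max_mult_distrib_right less_imp_neq[OF weight_pos, symmetric])
          finally show ?thesis .
        qed
        then have "?t n \<le> max (D / weight b n) (r / 2)"
          using r by (subst invlim_term_le_iff) (auto simp: le_max_iff_disj)
        also have "\<dots> < r" using elim r by simp
        finally show ?case .
      qed
    next
      fix r :: real assume "r < 0"
      then show "\<forall>\<^sub>F n in sequentially. r < ?t n"
        by (intro always_eventually allI) (rule less_le_trans[OF _ invlim_term_nonneg])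
    qed
  qed
  moreover have "witt_to_invlim p x \<in> carrier (invlim_witt_ring p)"
    using witt_to_invlim_iso[OF p char perfect]
    by (auto simp: ring_iso_def witt_ring_def bij_betw_def)
  ultimately show ?thesis by (simp add: invlim_b_def)
qed

lemma witt_to_invlim_image:
  assumes b: "b > 0"
  shows "witt_to_invlim p ` witt_b p N b = invlim_b p N b"
proof
  show "witt_to_invlim p ` witt_b p N b \<subseteq> invlim_b p N b"
    using witt_to_invlim_mem_iff[OF b] by blast
  show "invlim_b p N b \<subseteq> witt_to_invlim p ` witt_b p N b"
  proof
    fix y assume y: "y \<in> invlim_b p N b"
    then have "y \<in> carrier (invlim_witt_ring p)" by (simp add: invlim_b_def)
    then obtain x where "y = witt_to_invlim p x"
      using witt_to_invlim_surj[OF p char perfect] by metis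
    with y show "y \<in> witt_to_invlim p ` witt_b p N b"
      using witt_to_invlim_mem_iff[OF b] by blast
  qed
qed

lemma invlim_term_le_norm:
  assumes "y \<in> invlim_b p N b"
  shows "invlim_term p N b y n \<le> invlim_norm p N b y"
proof -
  have "Bseq (invlim_term p N b y)"
    using assms by (intro convergent_imp_Bseq) (auto simp: invlim_b_def convergent_def)
  then have "bdd_above (range (invlim_term p N b y))" by (rule Bseq_bdd_above)
  then show ?thesis unfolding invlim_norm_def by (intro cSUP_upper) simp
qed

lemma invlim_norm_nonneg: "y \<in> invlim_b p N b \<Longrightarrow> invlim_norm p N b y \<ge> 0"
  using invlim_term_le_norm[of y b 0] invlim_term_nonneg[of b y 0] by linarith

text \<open>As the weight is nondecreasing, the maximum over \<open>i \<le> n\<close> in the \<open>n\<close>-th term exceeds the bound only if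
  some single component does. All properties of the seminorm are derived from this description.\<close>

lemma invlim_norm_le_iff:
  assumes b: "b > 0" and x: "x \<in> witt_b p N b" and K: "K \<ge> 0"
  shows "invlim_norm p N b (witt_to_invlim p x) \<le> K \<longleftrightarrow> witt_bounded (\<lambda>i. K * weight b i) x"
proof -
  have y: "witt_to_invlim p x \<in> invlim_b p N b" using witt_to_invlim_mem_iff[OF b] x by simp
  have "invlim_norm p N b (witt_to_invlim p x) \<le> K
      \<longleftrightarrow> (\<forall>n. invlim_term p N b (witt_to_invlim p x) n \<le> K)"
    using invlim_term_le_norm[OF y] by (auto simp: invlim_norm_def intro: order_trans cSUP_least)
  also have "\<dots> \<longleftrightarrow> (\<forall>n. \<forall>i\<le>n. radius x i \<le> K * weight b n)"
    using K by (simp add: invlim_term_le_iff)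
  also have "\<dots> \<longleftrightarrow> (\<forall>i. radius x i \<le> K * weight b i)"
    using monoD[OF mono_weight[OF b K]] by (meson order_refl order_trans)
  finally show ?thesis using K by (simp add: witt_bounded_iff_radius)
qed

text \<open>Suppose that the claim fails. Let \<open>n\<close> be the first degree in which \<open>|x\<^sub>i| ^ (1 / p\<^sup>i) / p ^ (b i)\<close> attains its
  maximum \<open>M > K\<close>, and write \<open>x = s + t\<close> with \<open>s = V\<^sup>n[x\<^sub>n]\<close>. Then \<open>s\<^sup>2\<close> is concentrated in degree
  \<open>2 n\<close>, where it has weighted size \<open>M\<^sup>2\<close>, whereas every product \<open>V\<^sup>i[x\<^sub>i] V\<^sup>j[x\<^sub>j]\<close> in \<open>x\<^sup>2 - s\<^sup>2\<close> with
  \<open>i + j \<le> 2 n\<close> has a factor of index below \<open>n\<close> and is strictly smaller. Since \<open>x\<^sup>2\<close> has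
  weighted size at most \<open>K\<^sup>2 < M\<^sup>2\<close>, the difference \<open>s\<^sup>2\<close> would be too small in degree \<open>2 n\<close>.\<close>

lemma witt_bounded_of_square:
  assumes b: "b > 0" and x: "x \<in> witt_b p N b" and K: "K \<ge> 0"
    and square: "witt_bounded (\<lambda>i. K\<^sup>2 * weight b i) (witt_mult p x x)"
  shows "witt_bounded (\<lambda>i. K * weight b i) x"
proof (rule ccontr)
  define f where "f i = radius x i / weight b i" for i
  assume "\<not> witt_bounded (\<lambda>i. K * weight b i) x"
  then obtain m where m: "K < f m"
    using K by (auto simp: witt_bounded_iff_radius f_def not_le less_divide_eq)
  have lim: "f \<longlonglongrightarrow> 0" using x by (simp add: mem_witt_b_iff f_def[abs_def])
  have "f m > 0" using m K by simp
  from tendsto_0_attains_max[OF lim this]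
  obtain n where max: "\<And>i. f i \<le> f n" and first: "\<And>i. i < n \<Longrightarrow> f i < f n" by blast
  define M where "M = f n"
  have M: "K < M" "0 < M" using m max[of m] K by (simp_all add: M_def)
  define C where "C = Max (insert 0 (f ` {..<n}))"
  have C: "0 \<le> C" "C < M" "\<And>i. i < n \<Longrightarrow> f i \<le> C"
    using M first by (auto simp: C_def M_def)
  have radius: "radius x i = f i * weight b i" for i by (simp add: f_def less_imp_neq[OF weight_pos, symmetric])
  define s where "s = witt_single n (x n)"
  define t where "t = (\<lambda>i. if i = n then 0 else x i)"
  have x_eq: "x = witt_add p s t"
    by (subst witt_add_disjoint[OF p]) (auto simp: s_def t_def witt_single_def)
  define r where "r = witt_add p (witt_mult p t s) (witt_add p (witt_mult p s t) (witt_mult p t t))"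
  have square_eq: "witt_mult p x x = witt_add p (witt_mult p s s) r"
    unfolding x_eq r_def witt_distrib[OF p] witt_distrib_left[OF p] witt_add_assoc[OF p] ..
  (* The bound C * M holds up to degree 2 n because t vanishes in degree n, so that one of the two
     factors of a product t s, s t or t t contributes the constant C there. *)
  define e where "e i = (if i \<le> 2 * n then C * M * weight b i else M * M * weight b i)" for i
  define cs where "cs i = (if i = n then M * weight b i else 0)" for i
  define ct where "ct i = (if i < n then C * weight b i else if i = n then 0 else M * weight b i)" for i
  have CM: "C * C \<le> C * M" "C * M \<le> M * M" "C * M < M * M" using C M by (auto intro: mult_mono)
  have nonneg: "0 \<le> cs i" "0 \<le> ct i" "0 \<le> e i" for i
    using C M by (simp_all add: cs_def ct_def e_def)
  have "radius s i \<le> cs i" for i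
    using radius[of n] by (cases "i = n") (simp_all add: radius_def s_def witt_single_def cs_def N_zero M_def)
  then have s_bounded: "witt_bounded cs s" by (simp add: witt_bounded_iff_radius nonneg)
  have "radius t i \<le> ct i" for i
  proof (cases "i = n")
    case False
    then have "radius t i = f i * weight b i" using radius[of i] by (simp add: radius_def t_def)
    with False C(3)[of i] max[of i] show ?thesis by (auto simp: ct_def M_def intro: mult_right_mono)
  qed (simp add: radius_def t_def ct_def N_zero)
  then have t_bounded: "witt_bounded ct t" by (simp add: witt_bounded_iff_radius nonneg)
  have e_mono: "mono e"
    unfolding e_def using C M b CM
    by (intro monoI) (auto intro!: mult_mono weight_mono)
  have "witt_bounded e (witt_mult p t s)"
    by (rule witt_bounded_mult[OF e_mono nonneg(2,1) _ t_bounded s_bounded])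
       (use C M CM in \<open>auto simp: ct_def cs_def e_def weight_add mult_ac intro!: mult_mono\<close>)
  moreover have "witt_bounded e (witt_mult p s t)"
    using calculation by (simp add: witt_mult_commute[OF p, of s])
  moreover have "witt_bounded e (witt_mult p t t)"
    by (rule witt_bounded_mult[OF e_mono nonneg(2,2) _ t_bounded t_bounded])
       (use C M CM in \<open>auto simp: ct_def e_def weight_add mult_ac intro!: mult_mono\<close>)
  ultimately have "witt_bounded e r"
    unfolding r_def by (intro witt_bounded_add e_mono nonneg)
  then have neg_r: "witt_bounded e (witt_neg p r)" by (intro witt_bounded_neg e_mono nonneg)
  (* A constant bound in all degrees up to 2 n for x^2 and for the remaining products; it lies below
     the radius of s^2 in degree 2 n. *)
  define L where "L = max (K\<^sup>2) (C * M) * weight b (2 * n)"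
  have "K\<^sup>2 < M * M" using M K by (simp add: power2_eq_square mult_strict_mono)
  then have L: "0 \<le> L" "L < M * M * weight b (2 * n)"
    using CM by (auto simp: L_def le_max_iff_disj)
  have "N (witt_mult p x x i) \<le> L ^ (p ^ i)" if "i \<le> 2 * n" for i
  proof -
    have "N (witt_mult p x x i) \<le> (K\<^sup>2 * weight b (2 * n)) ^ (p ^ i)"
      using that b by (intro witt_bounded_le[OF mono_weight _ square]) simp_all
    also have "\<dots> \<le> L ^ (p ^ i)" by (intro power_mono) (simp_all add: L_def)
    finally show ?thesis .
  qed
  moreover have "N (witt_neg p r i) \<le> L ^ (p ^ i)" if "i \<le> 2 * n" for i
  proof -
    have "N (witt_neg p r i) \<le> e (2 * n) ^ (p ^ i)"
      using that by (intro witt_bounded_le[OF e_mono _ neg_r] nonneg)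
    also have "\<dots> \<le> L ^ (p ^ i)" by (intro power_mono nonneg) (simp add: L_def e_def)
    finally show ?thesis .
  qed
  ultimately have "N (witt_add p (witt_mult p x x) (witt_neg p r) (2 * n)) \<le> L ^ (p ^ (2 * n))"
    using L(1) by (intro N_witt_add)
  also have "witt_add p (witt_mult p x x) (witt_neg p r) = witt_mult p s s"
    by (simp add: square_eq witt_add_assoc[OF p] witt_add_commute[OF p, of r] witt_add_neg[OF p]
        witt_add_commute[OF p, of _ witt_zero] witt_add_zero[OF p])
  also have "witt_mult p s s (2 * n) = x n ^ (2 * p ^ n)"
    by (simp add: s_def witt_mult_single[OF p char] mult_2) (simp add: witt_single_def power_add)
  also have "N \<dots> = N (x n) ^ (2 * p ^ n)"
    using p_pos by (simp add: N_power)
  also have "N (x n) = (M * weight b n) ^ (p ^ n)"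
    using radius_power[of x n] by (simp add: radius M_def)
  also have "((M * weight b n) ^ (p ^ n)) ^ (2 * p ^ n) = (M * weight b n) ^ (p ^ n * (2 * p ^ n))"
    by (simp only: power_mult)
  also have "\<dots> = (M * M * weight b (2 * n)) ^ (p ^ (2 * n))"
  proof -
    have "M * M * weight b (2 * n) = (M * weight b n)\<^sup>2"
      using weight_add[of b n n] by (simp add: power2_eq_square flip: mult_2)
    moreover have "p ^ n * (2 * p ^ n) = 2 * p ^ (2 * n)" by (simp add: mult_2 power_add distrib_left)
    ultimately show ?thesis by (simp only: power_mult)
  qed
  finally have "M * M * weight b (2 * n) \<le> L"
    using L(1) M p_pos by (subst (asm) power_mono_iff) simp_all
  with L(2) show False by simp
qed

lemma invlim_norm_seminorm:
  assumes b: "b > 0"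
  shows "nonarch_seminorm ((invlim_witt_ring p)\<lparr>carrier := invlim_b p N b\<rparr>) (invlim_norm p N b)"
    and "power_multiplicative ((invlim_witt_ring p)\<lparr>carrier := invlim_b p N b\<rparr>) (invlim_norm p N b)"
proof -
  let ?f = "witt_to_invlim p :: (nat \<Rightarrow> 'a) \<Rightarrow> _" and ?W = "witt_ring p :: (nat \<Rightarrow> 'a) ring"
  let ?n = "invlim_norm p N b"
  have hom: "?f \<in> ring_hom ?W (invlim_witt_ring p)"
    using witt_to_invlim_iso[OF p char perfect] by (simp add: ring_iso_def)
  have add: "?f x \<oplus>\<^bsub>invlim_witt_ring p\<^esub> ?f y = ?f (witt_add p x y)" for x y
    using ring_hom_add[OF hom, of x y] by (simp add: witt_ring_def)
  have mult: "?f x \<otimes>\<^bsub>invlim_witt_ring p\<^esub> ?f y = ?f (witt_mult p x y)" for x y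
    using ring_hom_mult[OF hom, of x y] by (simp add: witt_ring_def)
  note image = witt_to_invlim_image[OF b, symmetric]
  have nonneg: "?n (?f x) \<ge> 0" if "x \<in> witt_b p N b" for x
    using that witt_to_invlim_mem_iff[OF b] by (intro invlim_norm_nonneg) simp
  have bounded: "witt_bounded (\<lambda>i. ?n (?f x) * weight b i) x" if "x \<in> witt_b p N b" for x
    using invlim_norm_le_iff[OF b that nonneg[OF that]] by simp
  have "?n (?f (witt_add p x y)) \<le> max (?n (?f x)) (?n (?f y))" (is "_ \<le> ?K")
    if x: "x \<in> witt_b p N b" and y: "y \<in> witt_b p N b" for x y
  proof -
    have K: "?K \<ge> 0" using nonneg[OF x] by simp
    have "witt_bounded (\<lambda>i. ?K * weight b i) x" "witt_bounded (\<lambda>i. ?K * weight b i) y"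
      using witt_bounded_mono[OF bounded[OF x]] witt_bounded_mono[OF bounded[OF y]] nonneg x y
      by (simp_all add: mult_right_mono)
    then have "witt_bounded (\<lambda>i. ?K * weight b i) (witt_add p x y)"
      using K by (intro witt_bounded_add mono_weight[OF b]) auto
    with invlim_norm_le_iff[OF b witt_b_add[OF b x y] K] show ?thesis by simp
  qed
  moreover have "?n \<zero>\<^bsub>invlim_witt_ring p\<^esub> = 0"
  proof -
    have zero: "witt_bounded (\<lambda>i. K * weight b i) witt_zero" if "K \<ge> 0" for K
      using that by (simp add: witt_bounded_def witt_zero_def N_zero)
    have mem: "witt_zero \<in> witt_b p N b"
      using p_pos by (simp add: mem_witt_b_iff radius_def witt_zero_def N_zero)
    have "?n (?f witt_zero) \<le> 0" using invlim_norm_le_iff[OF b mem, of 0] zero[of 0] by simp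
    with nonneg[OF mem] show ?thesis
      using witt_to_invlim_zero[OF p char perfect] by (simp add: witt_ring_def)
  qed
  ultimately show "nonarch_seminorm ((invlim_witt_ring p)\<lparr>carrier := invlim_b p N b\<rparr>) ?n"
    by (auto simp: nonarch_seminorm_def image add nonneg)
  have "?n (?f (witt_mult p x y)) \<le> ?n (?f x) * ?n (?f y)"
    if x: "x \<in> witt_b p N b" and y: "y \<in> witt_b p N b" for x y
  proof -
    have K: "?n (?f x) * ?n (?f y) \<ge> 0" using nonneg[OF x] nonneg[OF y] by simp
    have "witt_bounded (\<lambda>i. ?n (?f x) * ?n (?f y) * weight b i) (witt_mult p x y)"
      by (rule witt_bounded_mult[OF mono_weight[OF b K] _ _ _ bounded[OF x] bounded[OF y]])
         (simp_all add: nonneg x y weight_add mult_ac)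
    with invlim_norm_le_iff[OF b witt_b_mult[OF b x y] K] show ?thesis by simp
  qed
  moreover have "(?n (?f x))\<^sup>2 \<le> ?n (?f (witt_mult p x x))" if x: "x \<in> witt_b p N b" for x
  proof -
    let ?q = "?n (?f (witt_mult p x x))"
    have q: "?q \<ge> 0" using nonneg witt_b_mult[OF b x x] by simp
    have "witt_bounded (\<lambda>i. (sqrt ?q)\<^sup>2 * weight b i) (witt_mult p x x)"
      using bounded[OF witt_b_mult[OF b x x]] q by simp
    then have "witt_bounded (\<lambda>i. sqrt ?q * weight b i) x"
      using q by (intro witt_bounded_of_square[OF b x]) simp_all
    then have "?n (?f x) \<le> sqrt ?q" using invlim_norm_le_iff[OF b x] q by simp
    then show ?thesis using power_mono[OF _ nonneg[OF x], of "sqrt ?q" 2] q by simp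
  qed
  ultimately show "power_multiplicative ((invlim_witt_ring p)\<lparr>carrier := invlim_b p N b\<rparr>) ?n"
    by (auto simp: power_multiplicative_def submultiplicative_def image mult)
qed

end


section \<open>The comparison theorem\<close>

theorem theorem6p2:
  fixes p :: nat and N :: "'a::comm_ring_1 \<Rightarrow> real" and b :: real
  assumes "Factorial_Ring.prime p"
    and "CHAR('a) = p"
    and "bij (\<lambda>x::'a. x ^ p)"
    and "nonarch_seminorm (ring_of_type_algebra :: 'a ring) N"
    and "power_multiplicative (ring_of_type_algebra :: 'a ring) N"
    and "b > 0"
  shows
    "subring (invlim_b p N b) (invlim_witt_ring p) \<and>
     nonarch_seminorm ((invlim_witt_ring p)\<lparr>carrier := invlim_b p N b\<rparr>) (invlim_norm p N b) \<and>
     power_multiplicative ((invlim_witt_ring p)\<lparr>carrier := invlim_b p N b\<rparr>) (invlim_norm p N b) \<and>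
     witt_to_invlim p \<in> ring_iso (witt_ring p :: (nat \<Rightarrow> 'a) ring) (invlim_witt_ring p) \<and>
     subring (witt_b p N b) (witt_ring p) \<and>
     witt_to_invlim p ` witt_b p N b = invlim_b p N b \<and>
     subring (overconvergent_witt p N) (witt_ring p) \<and>
     witt_to_invlim p ` overconvergent_witt p N = invlim_dagger p N"
proof -
  interpret perfect_seminormed p N
    using assms(1-5)
    by unfold_locales (auto simp: nonarch_seminorm_def power_multiplicative_def submultiplicative_def
        ring_of_type_algebra_def)
  note iso = witt_to_invlim_iso[OF assms(1-3)]
  have "subring (invlim_b p N b) (invlim_witt_ring p)"
    using subring_witt_to_invlim_image[OF assms(1-3) subring_witt_b[OF assms(6)]]
    by (simp only: witt_to_invlim_image[OF assms(6)])
  moreover have "witt_to_invlim p ` overconvergent_witt p N = invlim_dagger p N"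
    by (simp add: overconvergent_witt_eq invlim_dagger_def image_UN witt_to_invlim_image)
  ultimately show ?thesis
    using invlim_norm_seminorm[OF assms(6)] iso subring_witt_b[OF assms(6)]
      witt_to_invlim_image[OF assms(6)] subring_overconvergent_witt by blast
qed

end
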